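(* Let $(\mathcal{A},\partial,\bar\partial)$ be the bicomplex of smooth $\mathbb{C}$-valued differential forms of a complex manifold, or, more generally, any bounded bicomplex. There is a short exact sequence of complexes $$0\to(\operatorname{Ker} d^c,d)\xrightarrow{\,i+\pi\,}(\mathcal{A},d)\oplus(H_{d^c},0)\xrightarrow{\,p-j\,}(\mathcal{A}/\operatorname{Im} d^c,d)\to0,$$ and therefore a long exact sequence in cohomology $$\cdots\xrightarrow{\delta_{k-1}}H^k(\operatorname{Ker} d^c)\xrightarrow{\,i+\pi\,}H^k_d\oplus H^k_{d^c}\xrightarrow{\,p-j\,}H^k(\mathcal{A}/\operatorname{Im} d^c)\xrightarrow{\,\delta_k\,}H^{k+1}(\operatorname{Ker} d^c)\to\cdots.$$
   Context: A bicomplex is a bigraded $\mathbb{C}$-vector space $\mathcal{A}=\bigoplus_{p,q\in\mathbb{Z}}\mathcal{A}^{p,q}$ with endomorphisms $\partial,\bar\partial$ of bidegrees $(1,0),(0,1)$ such that $d=\partial+\bar\partial$ satisfies $d^2=0$; bounded means $\mathcal{A}^{p,q}=0$ for all but finitely many $(p,q)$. Put $d^c=i(\bar\partial-\partial)$, so $dd^c+d^cd=0$. $H_d$ and $H_{d^c}$ are the cohomologies of $(\mathcal{A},d)$ and $(\mathcal{A},d^c)$, graded by total degree $p+q$. The complexes $\operatorname{Ker} d^c$ and $\mathcal{A}/\operatorname{Im} d^c$ carry the differential induced by $d$, and $H_{d^c}$ carries the zero differential (which is the one induced by $d$). $i:\operatorname{Ker} d^c\to\mathcal{A}$ is the inclusion,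 $\pi:\operatorname{Ker} d^c\to H_{d^c}$ and $p:\mathcal{A}\to\mathcal{A}/\operatorname{Im} d^c$ are the projections, $j:H_{d^c}\to\mathcal{A}/\operatorname{Im} d^c$ is the natural inclusion; $i+\pi$ denotes $x\mapsto(i(x),\pi(x))$ and $p-j$ denotes $(a,h)\mapsto p(a)-j(h)$. *)

theory Defs
  imports Complex_Main "HOL-Algebra.AbelCoset" "Jordan_Normal_Form.VS_Connect"
begin

section \<open>Quotient spaces\<close>

text \<open>
  Vector spaces are \<^typ>\<open>(complex, 'a) module\<close> records over \<^term>\<open>class_ring :: complex ring\<close>.
  The multiplicative fields of the records play no role; as in \<^const>\<open>direct_sum\<close> they are
  filled with zero.  In the scalar multiplication of cosets the summand \<open>N\<close> is needed
  for the scalar \<open>0\<close>.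
\<close>

definition quotient_space :: "(complex, 'a) module \<Rightarrow> 'a set \<Rightarrow> (complex, 'a set) module" where
  "quotient_space M N =
    \<lparr>carrier = a_rcosets\<^bsub>M\<^esub> N, mult = (\<lambda>X Y. N), one = N, zero = N, add = set_add M,
     smult = (\<lambda>c X. \<Union>x\<in>X. N +>\<^bsub>M\<^esub> (c \<odot>\<^bsub>M\<^esub> x))\<rparr>"

text \<open>
  The map that \<open>f\<close> induces from a quotient to \<open>M / N\<close>: it sends a coset \<open>X\<close> to the common
  value of the classes \<open>N + f x\<close>, \<open>x \<in> X\<close>, obtained as their union.  The union lies in the
  carrier of \<^term>\<open>quotient_space M N\<close> only if it is a single coset, so a linearity claim
  about an induced map contains its well-definedness.
\<close>

definition induced_map :: "(complex, 'b) module \<Rightarrow> 'b set \<Rightarrow> ('a \<Rightarrow> 'b) \<Rightarrow> 'a set \<Rightarrow> 'b set" where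
  "induced_map M N f X = (\<Union>x\<in>X. N +>\<^bsub>M\<^esub> f x)"

section \<open>Cochain complexes\<close>

record 'a cochain =
  obj :: "int \<Rightarrow> (complex, 'a) module"
  diff :: "int \<Rightarrow> 'a \<Rightarrow> 'a"

definition cochain_complex :: "'a cochain \<Rightarrow> bool" where
  "cochain_complex C \<longleftrightarrow>
    (\<forall>k. linear_map class_ring (obj C k) (obj C (k + 1)) (diff C k) \<and>
         (\<forall>x\<in>carrier (obj C k). diff C (k + 1) (diff C k x) = \<zero>\<^bsub>obj C (k + 2)\<^esub>))"

definition cocycles :: "'a cochain \<Rightarrow> int \<Rightarrow> 'a set" where
  "cocycles C k = a_kernel (obj C k) (obj C (k + 1)) (diff C k)"

definition coboundaries :: "'a cochain \<Rightarrow> int \<Rightarrow> 'a set" where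
  "coboundaries C k = diff C (k - 1) ` carrier (obj C (k - 1))"

definition cohomology :: "'a cochain \<Rightarrow> int \<Rightarrow> (complex, 'a set) module" where
  "cohomology C k = quotient_space ((obj C k)\<lparr>carrier := cocycles C k\<rparr>) (coboundaries C k)"

definition cohomology_class :: "'a cochain \<Rightarrow> int \<Rightarrow> 'a \<Rightarrow> 'a set" where
  "cohomology_class C k x = coboundaries C k +>\<^bsub>obj C k\<^esub> x"

definition cohomology_map :: "'b cochain \<Rightarrow> (int \<Rightarrow> 'a \<Rightarrow> 'b) \<Rightarrow> int \<Rightarrow> 'a set \<Rightarrow> 'b set" where
  "cohomology_map D f k = induced_map (obj D k) (coboundaries D k) (f k)"

definition chain_map :: "'a cochain \<Rightarrow> 'b cochain \<Rightarrow> (int \<Rightarrow> 'a \<Rightarrow> 'b) \<Rightarrow> bool" where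
  "chain_map C D f \<longleftrightarrow>
    (\<forall>k. linear_map class_ring (obj C k) (obj D k) (f k) \<and>
         (\<forall>x\<in>carrier (obj C k). f (k + 1) (diff C k x) = diff D k (f k x)))"

definition direct_sum_complex :: "'a cochain \<Rightarrow> 'b cochain \<Rightarrow> ('a \<times> 'b) cochain" where
  "direct_sum_complex C D =
    \<lparr>obj = (\<lambda>k. direct_sum (obj C k) (obj D k)),
     diff = (\<lambda>k (x, y). (diff C k x, diff D k y))\<rparr>"

definition exact_at ::
  "(complex, 'a) module \<Rightarrow> (complex, 'b) module \<Rightarrow> (complex, 'c) module \<Rightarrow>
    ('a \<Rightarrow> 'b) \<Rightarrow> ('b \<Rightarrow> 'c) \<Rightarrow> bool" where
  "exact_at L M N f g \<longleftrightarrow> f ` carrier L = a_kernel M N g"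

definition short_exact_complexes ::
  "'a cochain \<Rightarrow> 'b cochain \<Rightarrow> 'c cochain \<Rightarrow>
    (int \<Rightarrow> 'a \<Rightarrow> 'b) \<Rightarrow> (int \<Rightarrow> 'b \<Rightarrow> 'c) \<Rightarrow> bool" where
  "short_exact_complexes C D E f g \<longleftrightarrow>
    cochain_complex C \<and> cochain_complex D \<and> cochain_complex E \<and>
    chain_map C D f \<and> chain_map D E g \<and>
    (\<forall>k. inj_on (f k) (carrier (obj C k)) \<and>
         exact_at (obj C k) (obj D k) (obj E k) (f k) (g k) \<and>
         g k ` carrier (obj D k) = carrier (obj E k))"

text \<open>
  The connecting homomorphism of \<open>0 \<rightarrow> C \<rightarrow> D \<rightarrow> E \<rightarrow> 0\<close>, by the usual zig-zag: a class \<open>Z\<close> is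
  sent to the class of any \<open>x\<close> with \<open>f x = d b\<close>, where \<open>g b\<close> represents \<open>Z\<close>.  As in
  \<^const>\<open>induced_map\<close>, the union is over all choices.
\<close>

definition connecting_map ::
  "'a cochain \<Rightarrow> 'b cochain \<Rightarrow> (int \<Rightarrow> 'a \<Rightarrow> 'b) \<Rightarrow> (int \<Rightarrow> 'b \<Rightarrow> 'c) \<Rightarrow>
    int \<Rightarrow> 'c set \<Rightarrow> 'a set" where
  "connecting_map C D f g k Z =
    \<Union>{cohomology_class C (k + 1) x | x b.
        x \<in> carrier (obj C (k + 1)) \<and> b \<in> carrier (obj D k) \<and>
        g k b \<in> Z \<and> f (k + 1) x = diff D k b}"

text \<open>\<open>\<cdots> \<rightarrow> P k \<rightarrow> Q k \<rightarrow> R k \<rightarrow> P (k + 1) \<rightarrow> \<cdots>\<close>\<close>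

definition long_exact_sequence ::
  "(int \<Rightarrow> (complex, 'a) module) \<Rightarrow> (int \<Rightarrow> (complex, 'b) module) \<Rightarrow>
    (int \<Rightarrow> (complex, 'c) module) \<Rightarrow>
    (int \<Rightarrow> 'a \<Rightarrow> 'b) \<Rightarrow> (int \<Rightarrow> 'b \<Rightarrow> 'c) \<Rightarrow> (int \<Rightarrow> 'c \<Rightarrow> 'a) \<Rightarrow> bool" where
  "long_exact_sequence P Q R u v \<delta> \<longleftrightarrow>
    (\<forall>k. linear_map class_ring (P k) (Q k) (u k) \<and>
         linear_map class_ring (Q k) (R k) (v k) \<and>
         linear_map class_ring (R k) (P (k + 1)) (\<delta> k) \<and>
         exact_at (P k) (Q k) (R k) (u k) (v k) \<and>
         exact_at (Q k) (R k) (P (k + 1)) (v k) (\<delta> k) \<and>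
         exact_at (R k) (P (k + 1)) (Q (k + 1)) (\<delta> k) (u (k + 1)))"

section \<open>Bicomplexes\<close>

record 'a bigraded =
  ambient :: "(complex, 'a) module"
  piece :: "int \<Rightarrow> int \<Rightarrow> 'a set"
  del :: "'a \<Rightarrow> 'a"
  delbar :: "'a \<Rightarrow> 'a"

definition dtot :: "'a bigraded \<Rightarrow> 'a \<Rightarrow> 'a" where
  "dtot X x = del X x \<oplus>\<^bsub>ambient X\<^esub> delbar X x"

definition dc :: "'a bigraded \<Rightarrow> 'a \<Rightarrow> 'a" where
  "dc X x = \<i> \<odot>\<^bsub>ambient X\<^esub> (delbar X x \<ominus>\<^bsub>ambient X\<^esub> del X x)"

locale bicomplex =
  fixes X :: "'a bigraded"
  assumes vectorspace_ambient: "vectorspace class_ring (ambient X)"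
    and subspace_piece: "\<And>p q. VectorSpace.subspace class_ring (piece X p q) (ambient X)"
    and direct_sum_pieces: "\<And>x. x \<in> carrier (ambient X) \<Longrightarrow>
      \<exists>!c. (\<forall>p q. c p q \<in> piece X p q) \<and> finite {(p, q). c p q \<noteq> \<zero>\<^bsub>ambient X\<^esub>} \<and>
           x = finsum (ambient X) (\<lambda>(p, q). c p q) {(p, q). c p q \<noteq> \<zero>\<^bsub>ambient X\<^esub>}"
    and linear_del: "linear_map class_ring (ambient X) (ambient X) (del X)"
    and linear_delbar: "linear_map class_ring (ambient X) (ambient X) (delbar X)"
    and del_piece: "\<And>p q x. x \<in> piece X p q \<Longrightarrow> del X x \<in> piece X (p + 1) q"
    and delbar_piece: "\<And>p q x. x \<in> piece X p q \<Longrightarrow> delbar X x \<in> piece X p (q + 1)"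
    and dtot_dtot: "\<And>x. x \<in> carrier (ambient X) \<Longrightarrow> dtot X (dtot X x) = \<zero>\<^bsub>ambient X\<^esub>"

locale bounded_bicomplex = bicomplex +
  assumes bounded: "finite {(p, q). piece X p q \<noteq> {\<zero>\<^bsub>ambient X\<^esub>}}"

text \<open>The part of total degree \<open>k\<close>, i.e. the (internal) sum of the pieces \<open>(p, k - p)\<close>.\<close>

definition tot :: "'a bigraded \<Rightarrow> int \<Rightarrow> (complex, 'a) module" where
  "tot X k = (ambient X)\<lparr>carrier :=
    {finsum (ambient X) c S | c S. finite S \<and> (\<forall>p\<in>S. c p \<in> piece X p (k - p))}\<rparr>"

definition d_complex :: "'a bigraded \<Rightarrow> 'a cochain" where
  "d_complex X = \<lparr>obj = tot X, diff = (\<lambda>k. dtot X)\<rparr>"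

definition dc_complex :: "'a bigraded \<Rightarrow> 'a cochain" where
  "dc_complex X = \<lparr>obj = tot X, diff = (\<lambda>k. dc X)\<rparr>"

definition ker_dc :: "'a bigraded \<Rightarrow> 'a cochain" where
  "ker_dc X =
    \<lparr>obj = (\<lambda>k. (tot X k)\<lparr>carrier := cocycles (dc_complex X) k\<rparr>), diff = (\<lambda>k. dtot X)\<rparr>"

definition H_dc :: "'a bigraded \<Rightarrow> 'a set cochain" where
  "H_dc X =
    \<lparr>obj = cohomology (dc_complex X),
     diff = (\<lambda>k h. \<zero>\<^bsub>cohomology (dc_complex X) (k + 1)\<^esub>)\<rparr>"

definition coker_dc :: "'a bigraded \<Rightarrow> 'a set cochain" where
  "coker_dc X =
    \<lparr>obj = (\<lambda>k. quotient_space (tot X k) (coboundaries (dc_complex X) k)),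
     diff = (\<lambda>k. induced_map (tot X (k + 1)) (coboundaries (dc_complex X) (k + 1)) (dtot X))\<rparr>"

section \<open>The maps\<close>

definition incl :: "'a bigraded \<Rightarrow> int \<Rightarrow> 'a \<Rightarrow> 'a" where
  "incl X k x = x"

definition proj_H :: "'a bigraded \<Rightarrow> int \<Rightarrow> 'a \<Rightarrow> 'a set" where
  "proj_H X k x = cohomology_class (dc_complex X) k x"

definition proj_coker :: "'a bigraded \<Rightarrow> int \<Rightarrow> 'a \<Rightarrow> 'a set" where
  "proj_coker X k a = coboundaries (dc_complex X) k +>\<^bsub>tot X k\<^esub> a"

text \<open>
  An element of \<open>H\<^sub>d\<^sub>c\<close> is a coset of \<open>Im d\<^sup>c\<close> all of whose elements lie in \<open>Ker d\<^sup>c\<close>; as a set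
  it is also an element of \<open>A / Im d\<^sup>c\<close>, so the natural inclusion is the identity on cosets.
\<close>

definition incl_H :: "'a bigraded \<Rightarrow> int \<Rightarrow> 'a set \<Rightarrow> 'a set" where
  "incl_H X k h = h"

definition i_plus_pi :: "'a bigraded \<Rightarrow> int \<Rightarrow> 'a \<Rightarrow> 'a \<times> 'a set" where
  "i_plus_pi X k x = (incl X k x, proj_H X k x)"

definition p_minus_j :: "'a bigraded \<Rightarrow> int \<Rightarrow> 'a \<times> 'a set \<Rightarrow> 'a set" where
  "p_minus_j X k = (\<lambda>(a, h). proj_coker X k a \<ominus>\<^bsub>obj (coker_dc X) k\<^esub> incl_H X k h)"

text \<open>
  In cohomology, \<open>H\<^sup>k(H\<^sub>d\<^sub>c, 0)\<close> is identified with \<open>H\<^sup>k\<^sub>d\<^sub>c\<close> itself.  Accordingly the second component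
  of \<open>i + \<pi>\<close> on a class \<open>Y\<close> is the common value of \<open>\<pi>\<close> on the elements of \<open>Y\<close>, written as a
  union as in \<^const>\<open>induced_map\<close>, and \<open>j\<close> sends \<open>h\<close> to the class of the cocycle \<open>j h\<close>.
\<close>

definition i_plus_pi_cohomology :: "'a bigraded \<Rightarrow> int \<Rightarrow> 'a set \<Rightarrow> 'a set \<times> 'a set" where
  "i_plus_pi_cohomology X k Y =
    (cohomology_map (d_complex X) (incl X) k Y, \<Union>y\<in>Y. proj_H X k y)"

definition p_minus_j_cohomology ::
  "'a bigraded \<Rightarrow> int \<Rightarrow> 'a set \<times> 'a set \<Rightarrow> 'a set set" where
  "p_minus_j_cohomology X k = (\<lambda>(Y, h).
    cohomology_map (coker_dc X) (proj_coker X) k Y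
      \<ominus>\<^bsub>cohomology (coker_dc X) k\<^esub> cohomology_class (coker_dc X) k (incl_H X k h))"

end

theory Submission
  imports Defs
begin

text \<open>
  Everything rests on one fact about a bicomplex: \<open>d\<close> maps \<open>Ker d\<^sup>c\<close> into \<open>Im d\<^sup>c\<close>. Let \<open>N\<close> be the
  operator that multiplies \<open>A\<^bsup>p,q\<^esup>\<close> by \<open>p\<close>. As \<open>\<partial>\<close> raises \<open>p\<close> by one and the conjugate operator
  preserves it, \<open>d\<^sup>c N - N d\<^sup>c = i \<partial>\<close>. If \<open>d\<^sup>c x = 0\<close>, then \<open>\<partial> x\<close> agrees with the conjugate derivative of
  \<open>x\<close>, so \<open>d x = 2 \<partial> x = d\<^sup>c (- 2 i N x)\<close>. This is lemma \<open>dtot_in_image_dc\<close>. The kernel of \<open>d\<^sup>c\<close> is not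
  the sum of its bihomogeneous parts, so the argument has to compare components of different
  bidegree; the uniqueness of components needed for that is lemma \<open>components_zero\<close>.

  The fact has two uses. Because \<open>Im d\<^sup>c\<close> is contained in \<open>Ker d\<^sup>c\<close>, it shows that \<open>d\<close> preserves both
  and hence acts on \<open>Ker d\<^sup>c\<close> and on \<open>A / Im d\<^sup>c\<close>. Moreover \<open>\<pi>\<close> and the inclusion \<open>j\<close> commute with
  the differentials when \<open>H\<^sub>d\<^sub>c\<close> carries the zero differential. Degreewise exactness is then immediate:
  \<open>p a = j h\<close> says that the coset \<open>h\<close> contains \<open>a\<close>, which forces \<open>a\<close> to lie in \<open>Ker d\<^sup>c\<close> with \<open>\<pi> a = h\<close>.

  The long sequence comes from the snake lemma for an arbitrary short exact sequence of complexes
  (locale \<open>short_exact\<close>). The cohomology of its middle term is identified with \<open>H\<^sub>d \<oplus> H\<^sub>d\<^sub>c\<close>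
  by the isomorphism \<open>split_class\<close>, and exactness is carried across by
  \<open>long_exact_sequence_transport\<close>.
\<close>

section \<open>Complex vector spaces and linear maps\<close>

abbreviation vspace :: "(complex, 'a) module \<Rightarrow> bool" where
  "vspace M \<equiv> vectorspace class_ring M"

abbreviation lin :: "(complex, 'a) module \<Rightarrow> (complex, 'b) module \<Rightarrow> ('a \<Rightarrow> 'b) \<Rightarrow> bool" where
  "lin M N f \<equiv> linear_map class_ring M N f"

abbreviation subsp :: "(complex, 'a) module \<Rightarrow> 'a set \<Rightarrow> bool" where
  "subsp M W \<equiv> VectorSpace.subspace class_ring W M"

lemma vspace_abelian_group: "vspace M \<Longrightarrow> abelian_group M"
  unfolding vectorspace_def Module.module_def by blast

lemma vspace_smult:
  assumes "vspace M"
  shows "x \<in> carrier M \<Longrightarrow> c \<odot>\<^bsub>M\<^esub> x \<in> carrier M"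
    and "x \<in> carrier M \<Longrightarrow> (a + b) \<odot>\<^bsub>M\<^esub> x = a \<odot>\<^bsub>M\<^esub> x \<oplus>\<^bsub>M\<^esub> b \<odot>\<^bsub>M\<^esub> x"
    and "x \<in> carrier M \<Longrightarrow> y \<in> carrier M \<Longrightarrow> c \<odot>\<^bsub>M\<^esub> (x \<oplus>\<^bsub>M\<^esub> y) = c \<odot>\<^bsub>M\<^esub> x \<oplus>\<^bsub>M\<^esub> c \<odot>\<^bsub>M\<^esub> y"
    and "x \<in> carrier M \<Longrightarrow> (a * b) \<odot>\<^bsub>M\<^esub> x = a \<odot>\<^bsub>M\<^esub> (b \<odot>\<^bsub>M\<^esub> x)"
    and "x \<in> carrier M \<Longrightarrow> 1 \<odot>\<^bsub>M\<^esub> x = x"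
    and "x \<in> carrier M \<Longrightarrow> 0 \<odot>\<^bsub>M\<^esub> x = \<zero>\<^bsub>M\<^esub>"
    and "c \<odot>\<^bsub>M\<^esub> \<zero>\<^bsub>M\<^esub> = \<zero>\<^bsub>M\<^esub>"
    and "x \<in> carrier M \<Longrightarrow> (- 1) \<odot>\<^bsub>M\<^esub> x = \<ominus>\<^bsub>M\<^esub> x"
proof -
  interpret vectorspace class_ring M by fact
  show "x \<in> carrier M \<Longrightarrow> c \<odot>\<^bsub>M\<^esub> x \<in> carrier M"
    "x \<in> carrier M \<Longrightarrow> (a + b) \<odot>\<^bsub>M\<^esub> x = a \<odot>\<^bsub>M\<^esub> x \<oplus>\<^bsub>M\<^esub> b \<odot>\<^bsub>M\<^esub> x"
    "x \<in> carrier M \<Longrightarrow> y \<in> carrier M \<Longrightarrow> c \<odot>\<^bsub>M\<^esub> (x \<oplus>\<^bsub>M\<^esub> y) = c \<odot>\<^bsub>M\<^esub> x \<oplus>\<^bsub>M\<^esub> c \<odot>\<^bsub>M\<^esub> y"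
    "x \<in> carrier M \<Longrightarrow> (a * b) \<odot>\<^bsub>M\<^esub> x = a \<odot>\<^bsub>M\<^esub> (b \<odot>\<^bsub>M\<^esub> x)"
    "x \<in> carrier M \<Longrightarrow> 1 \<odot>\<^bsub>M\<^esub> x = x"
    "x \<in> carrier M \<Longrightarrow> 0 \<odot>\<^bsub>M\<^esub> x = \<zero>\<^bsub>M\<^esub>"
    "c \<odot>\<^bsub>M\<^esub> \<zero>\<^bsub>M\<^esub> = \<zero>\<^bsub>M\<^esub>"
    "x \<in> carrier M \<Longrightarrow> (- 1) \<odot>\<^bsub>M\<^esub> x = \<ominus>\<^bsub>M\<^esub> x"
    using smult_closed[of c x] smult_l_distr[of a b x] smult_r_distr[of c x y] smult_assoc1[of a b x]
      smult_one[of x] smult_l_null[of x] smult_r_null[of c] smult_minus_1[of x]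
    by (auto simp: class_ring_simps)
qed

lemma vspaceI:
  assumes "abelian_group M"
    and "\<And>c x. x \<in> carrier M \<Longrightarrow> c \<odot>\<^bsub>M\<^esub> x \<in> carrier M"
    and "\<And>a b x. x \<in> carrier M \<Longrightarrow> (a + b) \<odot>\<^bsub>M\<^esub> x = a \<odot>\<^bsub>M\<^esub> x \<oplus>\<^bsub>M\<^esub> b \<odot>\<^bsub>M\<^esub> x"
    and "\<And>c x y. x \<in> carrier M \<Longrightarrow> y \<in> carrier M \<Longrightarrow> c \<odot>\<^bsub>M\<^esub> (x \<oplus>\<^bsub>M\<^esub> y) = c \<odot>\<^bsub>M\<^esub> x \<oplus>\<^bsub>M\<^esub> c \<odot>\<^bsub>M\<^esub> y"
    and "\<And>a b x. x \<in> carrier M \<Longrightarrow> (a * b) \<odot>\<^bsub>M\<^esub> x = a \<odot>\<^bsub>M\<^esub> (b \<odot>\<^bsub>M\<^esub> x)"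
    and "\<And>x. x \<in> carrier M \<Longrightarrow> 1 \<odot>\<^bsub>M\<^esub> x = x"
  shows "vspace M"
proof -
  have "field (class_ring :: complex ring)" by (rule class_field.field_axioms)
  moreover have "cring (class_ring :: complex ring)" by (rule class_cring.cring_axioms)
  ultimately show ?thesis
    unfolding vectorspace_def by (auto intro!: moduleI simp: assms)
qed

lemma subspI:
  assumes "vspace M" "W \<subseteq> carrier M" "\<zero>\<^bsub>M\<^esub> \<in> W"
    and "\<And>x y. x \<in> W \<Longrightarrow> y \<in> W \<Longrightarrow> x \<oplus>\<^bsub>M\<^esub> y \<in> W"
    and "\<And>c x. x \<in> W \<Longrightarrow> c \<odot>\<^bsub>M\<^esub> x \<in> W"
  shows "subsp M W"
  using assms unfolding VectorSpace.subspace_def LinearCombinations.submodule_def vectorspace_def by auto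

lemma subspD:
  assumes "subsp M W"
  shows "vspace M" "W \<subseteq> carrier M" "\<zero>\<^bsub>M\<^esub> \<in> W"
    and "x \<in> W \<Longrightarrow> y \<in> W \<Longrightarrow> x \<oplus>\<^bsub>M\<^esub> y \<in> W"
    and "x \<in> W \<Longrightarrow> c \<odot>\<^bsub>M\<^esub> x \<in> W"
    and "x \<in> W \<Longrightarrow> x \<in> carrier M"
    and "x \<in> W \<Longrightarrow> \<ominus>\<^bsub>M\<^esub> x \<in> W"
    and "x \<in> W \<Longrightarrow> y \<in> W \<Longrightarrow> x \<ominus>\<^bsub>M\<^esub> y \<in> W"
    and "vspace (M\<lparr>carrier := W\<rparr>)"
proof -
  show 1: "vspace M" and 2: "W \<subseteq> carrier M" and "\<zero>\<^bsub>M\<^esub> \<in> W"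
    and 3: "\<And>x y. x \<in> W \<Longrightarrow> y \<in> W \<Longrightarrow> x \<oplus>\<^bsub>M\<^esub> y \<in> W"
    and 4: "\<And>c x. x \<in> W \<Longrightarrow> c \<odot>\<^bsub>M\<^esub> x \<in> W"
    using assms unfolding VectorSpace.subspace_def LinearCombinations.submodule_def by auto
  show "x \<in> W \<Longrightarrow> x \<in> carrier M" using 2 by blast
  have 5: "\<ominus>\<^bsub>M\<^esub> x \<in> W" if "x \<in> W" for x
    using 4[OF that, of "- 1"] vspace_smult(8)[OF 1, of x] that 2 by auto
  then show "x \<in> W \<Longrightarrow> \<ominus>\<^bsub>M\<^esub> x \<in> W" .
  show "x \<in> W \<Longrightarrow> y \<in> W \<Longrightarrow> x \<ominus>\<^bsub>M\<^esub> y \<in> W"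
    unfolding a_minus_def by (intro 3 5)
  show "vspace (M\<lparr>carrier := W\<rparr>)"
    by (rule vectorspace.subspace_is_vs[OF 1 assms])
qed

lemma linI:
  assumes "vspace M" "vspace N"
    and "\<And>x. x \<in> carrier M \<Longrightarrow> f x \<in> carrier N"
    and "\<And>x y. x \<in> carrier M \<Longrightarrow> y \<in> carrier M \<Longrightarrow> f (x \<oplus>\<^bsub>M\<^esub> y) = f x \<oplus>\<^bsub>N\<^esub> f y"
    and "\<And>c x. x \<in> carrier M \<Longrightarrow> f (c \<odot>\<^bsub>M\<^esub> x) = c \<odot>\<^bsub>N\<^esub> f x"
  shows "lin M N f"
  using assms unfolding linear_map_def mod_hom_def mod_hom_axioms_def LinearCombinations.module_hom_def vectorspace_def
  by auto

lemma linD: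
  assumes "lin M N f"
  shows "vspace M" "vspace N"
    and "x \<in> carrier M \<Longrightarrow> f x \<in> carrier N"
    and "x \<in> carrier M \<Longrightarrow> y \<in> carrier M \<Longrightarrow> f (x \<oplus>\<^bsub>M\<^esub> y) = f x \<oplus>\<^bsub>N\<^esub> f y"
    and "x \<in> carrier M \<Longrightarrow> f (c \<odot>\<^bsub>M\<^esub> x) = c \<odot>\<^bsub>N\<^esub> f x"
    and "f \<zero>\<^bsub>M\<^esub> = \<zero>\<^bsub>N\<^esub>"
    and "x \<in> carrier M \<Longrightarrow> f (\<ominus>\<^bsub>M\<^esub> x) = \<ominus>\<^bsub>N\<^esub> f x"
    and "x \<in> carrier M \<Longrightarrow> y \<in> carrier M \<Longrightarrow> f (x \<ominus>\<^bsub>M\<^esub> y) = f x \<ominus>\<^bsub>N\<^esub> f y"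
proof -
  interpret linear_map class_ring M N f by fact
  show "vspace M" "vspace N" by unfold_locales
  show "x \<in> carrier M \<Longrightarrow> f x \<in> carrier N"
    "x \<in> carrier M \<Longrightarrow> y \<in> carrier M \<Longrightarrow> f (x \<oplus>\<^bsub>M\<^esub> y) = f x \<oplus>\<^bsub>N\<^esub> f y"
    "f \<zero>\<^bsub>M\<^esub> = \<zero>\<^bsub>N\<^esub>"
    "x \<in> carrier M \<Longrightarrow> f (\<ominus>\<^bsub>M\<^esub> x) = \<ominus>\<^bsub>N\<^esub> f x"
    "x \<in> carrier M \<Longrightarrow> y \<in> carrier M \<Longrightarrow> f (x \<ominus>\<^bsub>M\<^esub> y) = f x \<ominus>\<^bsub>N\<^esub> f y"
    by auto
  show "x \<in> carrier M \<Longrightarrow> f (c \<odot>\<^bsub>M\<^esub> x) = c \<odot>\<^bsub>N\<^esub> f x"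
    using f_smult[of c x] by simp
qed

text \<open>
  Inversion in a record refers to its carrier, while addition and scalar multiplication do not.
  Differences in a subspace and in the ambient space are compared through this formula.
\<close>
lemma a_minus_smult:
  assumes "vspace M" "y \<in> carrier M"
  shows "x \<ominus>\<^bsub>M\<^esub> y = x \<oplus>\<^bsub>M\<^esub> (- 1) \<odot>\<^bsub>M\<^esub> y"
  using vspace_smult(8)[OF assms] by (simp add: a_minus_def)

lemma lin_zero:
  assumes "vspace M" "vspace N"
  shows "lin M N (\<lambda>x. \<zero>\<^bsub>N\<^esub>)"
proof -
  interpret N: abelian_group N by (rule vspace_abelian_group[OF assms(2)])
  show ?thesis using vspace_smult(7)[OF assms(2)] by (intro linI assms) auto
qed

lemma lin_smult:
  assumes "vspace M"
  shows "lin M M (\<lambda>x. a \<odot>\<^bsub>M\<^esub> x)"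
proof (rule linI[OF assms assms])
  fix c x assume "x \<in> carrier M"
  then show "a \<odot>\<^bsub>M\<^esub> (c \<odot>\<^bsub>M\<^esub> x) = c \<odot>\<^bsub>M\<^esub> (a \<odot>\<^bsub>M\<^esub> x)"
    using vspace_smult(4)[OF assms, of x a c] vspace_smult(4)[OF assms, of x c a] by (simp add: mult.commute)
qed (auto simp: vspace_smult[OF assms])

lemma direct_sum_simps [simp]:
  "carrier (direct_sum M N) = carrier M \<times> carrier N"
  "\<zero>\<^bsub>direct_sum M N\<^esub> = (\<zero>\<^bsub>M\<^esub>, \<zero>\<^bsub>N\<^esub>)"
  "(x, y) \<oplus>\<^bsub>direct_sum M N\<^esub> (x', y') = (x \<oplus>\<^bsub>M\<^esub> x', y \<oplus>\<^bsub>N\<^esub> y')"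
  "c \<odot>\<^bsub>direct_sum M N\<^esub> (x, y) = (c \<odot>\<^bsub>M\<^esub> x, c \<odot>\<^bsub>N\<^esub> y)"
  by (simp_all add: direct_sum_def)

lemma lin_pair:
  assumes "lin M N f" "lin M N' g"
  shows "lin M (direct_sum N N') (\<lambda>x. (f x, g x))"
  using linD(3-5)[OF assms(1)] linD(3-5)[OF assms(2)]
  by (intro linI linD(1)[OF assms(1)] direct_sum_is_vs linD(2)[OF assms(1)] linD(2)[OF assms(2)]) auto

lemma lin_prod:
  assumes "lin M N f" "lin M' N' g"
  shows "lin (direct_sum M M') (direct_sum N N') (\<lambda>(x, y). (f x, g y))"
  using linD(3-5)[OF assms(1)] linD(3-5)[OF assms(2)]
  by (intro linI direct_sum_is_vs linD(1,2)[OF assms(1)] linD(1,2)[OF assms(2)]) auto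

lemma lin_difference:
  assumes "lin M N f" "lin M' N g"
  shows "lin (direct_sum M M') N (\<lambda>(x, y). f x \<ominus>\<^bsub>N\<^esub> g y)"
proof -
  note l = linD[OF assms(1)] linD(1,3-)[OF assms(2)]
  interpret N: abelian_group N by (rule vspace_abelian_group[OF l(2)])
  show ?thesis
    using l(3-) by (intro linI direct_sum_is_vs l(1,2,9))
      (auto simp: a_minus_smult[OF l(2)] vspace_smult(1,3)[OF l(2)] linD(5)[OF lin_smult[OF l(2)]] N.a_ac)
qed

lemma lin_cong:
  assumes "lin M N f" "\<And>x. x \<in> carrier M \<Longrightarrow> g x = f x"
  shows "lin M N g"
proof -
  interpret M: abelian_group M by (rule vspace_abelian_group[OF linD(1)[OF assms(1)]])
  show ?thesis
    using linD[OF assms(1)] assms(2) by (intro linI) (auto simp: vspace_smult(1)[OF linD(1)[OF assms(1)]])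
qed

lemma lin_comp:
  assumes "lin L M f" "lin M N g"
  shows "lin L N (\<lambda>x. g (f x))"
  using linD[OF assms(1)] linD[OF assms(2)] by (intro linI) auto

lemma a_kernel_iff: "x \<in> a_kernel M N f \<longleftrightarrow> x \<in> carrier M \<and> f x = \<zero>\<^bsub>N\<^esub>"
  unfolding a_kernel_def kernel_def by simp

lemma subsp_kernel: "lin M N f \<Longrightarrow> subsp M (a_kernel M N f)"
  using linD[of M N f] abelian_group.axioms(1)[OF vspace_abelian_group[of M]]
    abelian_group.axioms(1)[OF vspace_abelian_group[of N]]
  by (intro subspI) (auto simp: a_kernel_iff vspace_smult abelian_monoid.zero_closed abelian_monoid.a_closed
      abelian_monoid.l_zero)

lemma subsp_image:
  assumes "lin M N f"
  shows "subsp N (f ` carrier M)"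
proof -
  note l = linD[OF assms]
  interpret M: abelian_group M by (rule vspace_abelian_group[OF l(1)])
  show ?thesis
  proof (rule subspI[OF l(2)])
    show "\<zero>\<^bsub>N\<^esub> \<in> f ` carrier M"
      using l(6) M.zero_closed by (metis imageI)
    show "x \<oplus>\<^bsub>N\<^esub> y \<in> f ` carrier M" if "x \<in> f ` carrier M" "y \<in> f ` carrier M" for x y
      using that M.a_closed by (auto simp flip: l(4))
    show "c \<odot>\<^bsub>N\<^esub> x \<in> f ` carrier M" if "x \<in> f ` carrier M" for c x
      using that vspace_smult(1)[OF l(1)] by (auto simp flip: l(5))
  qed (use l(3) in auto)
qed

lemma subsp_restrict:
  assumes "subsp M W" "N \<subseteq> W" "subsp M N"
  shows "subsp (M\<lparr>carrier := W\<rparr>) N"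
  using assms subspD[OF assms(1)] subspD[OF assms(3)]
  by (intro subspI) auto

section \<open>Cosets and quotient spaces\<close>

text \<open>
  Cohomology is a quotient of the cocycles, a space with restricted carrier, but its cosets may be
  computed in the full space.
\<close>
lemma coset_restrict [simp]: "N +>\<^bsub>M\<lparr>carrier := W\<rparr>\<^esub> x = N +>\<^bsub>M\<^esub> x"
  by (simp add: a_r_coset_def')

lemma coset_mem: "y \<in> N +>\<^bsub>M\<^esub> x \<longleftrightarrow> (\<exists>n\<in>N. y = n \<oplus>\<^bsub>M\<^esub> x)"
  by (auto simp: a_r_coset_def')

locale quotient =
  fixes M :: "(complex, 'a) module" and N :: "'a set"
  assumes sub: "subsp M N"
begin

lemma vs: "vspace M" by (rule subspD[OF sub])

sublocale M: abelian_group M by (rule vspace_abelian_group[OF vs])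

lemma subgrp: "subgroup N (add_monoid M)"
  using subspD[OF sub] by (intro M.add.subgroupI) auto

abbreviation cls :: "'a \<Rightarrow> 'a set" where "cls x \<equiv> N +>\<^bsub>M\<^esub> x"

lemma sub_carrier: "n \<in> N \<Longrightarrow> n \<in> carrier M"
  by (rule subspD(6)[OF sub])

lemma cls_self: "x \<in> carrier M \<Longrightarrow> x \<in> cls x"
  using subspD(3)[OF sub] by (auto simp: coset_mem intro!: bexI[of _ "\<zero>\<^bsub>M\<^esub>"])

lemma cls_eqI: "y \<in> cls x \<Longrightarrow> x \<in> carrier M \<Longrightarrow> cls y = cls x"
  using M.a_repr_independence[OF _ _ subgrp, of y x] by simp

lemma cls_eq_iff:
  assumes "x \<in> carrier M" "y \<in> carrier M"
  shows "cls x = cls y \<longleftrightarrow> (\<exists>n\<in>N. x = n \<oplus>\<^bsub>M\<^esub> y)"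
  using cls_eqI[of x y] cls_self[of x] assms by (auto simp: coset_mem)

lemma cls_zero: "cls \<zero>\<^bsub>M\<^esub> = N"
  using subspD(2)[OF sub] by simp

lemma cls_eq_zero_iff: "x \<in> carrier M \<Longrightarrow> cls x = N \<longleftrightarrow> x \<in> N"
  using cls_eq_iff[of x "\<zero>\<^bsub>M\<^esub>"] cls_zero sub_carrier M.r_zero by auto

abbreviation Q where "Q \<equiv> quotient_space M N"

lemma carrier_Q: "carrier Q = cls ` carrier M"
  by (auto simp: quotient_space_def A_RCOSETS_def')

lemma zero_Q: "\<zero>\<^bsub>Q\<^esub> = N"
  by (simp add: quotient_space_def)

lemma add_Q:
  assumes "x \<in> carrier M" "y \<in> carrier M"
  shows "cls x \<oplus>\<^bsub>Q\<^esub> cls y = cls (x \<oplus>\<^bsub>M\<^esub> y)"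
proof -
  interpret abelian_subgroup N M
    by (intro abelian_subgroupI3 additive_subgroupI subgrp M.abelian_group_axioms)
  show ?thesis using a_rcos_sum[OF assms] by (simp add: quotient_space_def)
qed

lemma smult_Q:
  assumes "x \<in> carrier M"
  shows "c \<odot>\<^bsub>Q\<^esub> cls x = cls (c \<odot>\<^bsub>M\<^esub> x)"
proof -
  have "cls (c \<odot>\<^bsub>M\<^esub> y) = cls (c \<odot>\<^bsub>M\<^esub> x)" if "y \<in> cls x" for y
  proof -
    from that obtain n where "n \<in> N" "y = n \<oplus>\<^bsub>M\<^esub> x" by (auto simp: coset_mem)
    then show ?thesis
      using assms sub_carrier subspD(5)[OF sub]
      by (intro cls_eqI) (auto simp: coset_mem vspace_smult[OF vs])
  qed
  moreover have "c \<odot>\<^bsub>Q\<^esub> cls x = (\<Union>y\<in>cls x. cls (c \<odot>\<^bsub>M\<^esub> y))"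
    by (simp add: quotient_space_def)
  ultimately show ?thesis using cls_self[OF assms] by blast
qed

lemma vspace_Q: "vspace Q"
proof (rule vspaceI)
  show "abelian_group Q"
  proof (rule abelian_groupI)
    show "\<exists>y\<in>carrier Q. y \<oplus>\<^bsub>Q\<^esub> x = \<zero>\<^bsub>Q\<^esub>" if x: "x \<in> carrier Q" for x
    proof -
      obtain a where a: "a \<in> carrier M" "x = cls a" using x by (auto simp: carrier_Q)
      then have "cls (\<ominus>\<^bsub>M\<^esub> a) \<oplus>\<^bsub>Q\<^esub> x = \<zero>\<^bsub>Q\<^esub>"
        by (simp add: add_Q zero_Q M.l_neg cls_zero)
      then show ?thesis using a by (auto simp: carrier_Q)
    qed
    show "\<zero>\<^bsub>Q\<^esub> \<in> carrier Q"
      using M.zero_closed unfolding carrier_Q zero_Q by (subst cls_zero[symmetric]) (rule imageI)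
    show "\<zero>\<^bsub>Q\<^esub> \<oplus>\<^bsub>Q\<^esub> x = x" if "x \<in> carrier Q" for x
      using that add_Q[of "\<zero>\<^bsub>M\<^esub>"] by (auto simp: carrier_Q zero_Q cls_zero)
  qed (auto simp: carrier_Q add_Q M.a_ac)
qed (auto simp: carrier_Q add_Q smult_Q vspace_smult[OF vs])

lemma lin_cls: "lin M Q cls"
  by (rule linI[OF vs vspace_Q]) (auto simp: carrier_Q add_Q smult_Q)

lemma minus_Q: "x \<in> carrier M \<Longrightarrow> y \<in> carrier M \<Longrightarrow> cls x \<ominus>\<^bsub>Q\<^esub> cls y = cls (x \<ominus>\<^bsub>M\<^esub> y)"
  using linD(8)[OF lin_cls] by simp

text \<open>
  An induced map is a union over representatives; once the value does not depend on the
  representative, the union is a single coset.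
\<close>
lemma induced_map_cls:
  assumes "x \<in> carrier M" "\<And>n. n \<in> N \<Longrightarrow> N' +>\<^bsub>M'\<^esub> f (n \<oplus>\<^bsub>M\<^esub> x) = N' +>\<^bsub>M'\<^esub> f x"
  shows "induced_map M' N' f (cls x) = N' +>\<^bsub>M'\<^esub> f x"
proof -
  have "N' +>\<^bsub>M'\<^esub> f y = N' +>\<^bsub>M'\<^esub> f x" if "y \<in> cls x" for y
    using that assms(2) by (auto simp: coset_mem)
  then show ?thesis
    using cls_self[OF assms(1)] unfolding induced_map_def by blast
qed

end

lemma induced_map_lin:
  assumes "subsp M N" "subsp M' N'" "lin M M' f" "f ` N \<subseteq> N'" "x \<in> carrier M"
  shows "induced_map M' N' f (N +>\<^bsub>M\<^esub> x) = N' +>\<^bsub>M'\<^esub> f x"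
proof -
  interpret Q: quotient M N by (rule quotient.intro) fact
  interpret Q': quotient M' N' by (rule quotient.intro) fact
  show ?thesis
  proof (rule Q.induced_map_cls[OF assms(5)])
    fix n assume n: "n \<in> N"
    show "N' +>\<^bsub>M'\<^esub> f (n \<oplus>\<^bsub>M\<^esub> x) = N' +>\<^bsub>M'\<^esub> f x"
      using n assms(4,5) linD(3,4)[OF assms(3)] Q.sub_carrier[OF n]
      by (intro Q'.cls_eqI) (auto simp: coset_mem)
  qed
qed

lemma lin_induced_map:
  assumes "subsp M N" "subsp M' N'" "lin M M' f" "f ` N \<subseteq> N'"
  shows "lin (quotient_space M N) (quotient_space M' N') (induced_map M' N' f)"
proof -
  interpret Q: quotient M N by (rule quotient.intro) fact
  interpret Q': quotient M' N' by (rule quotient.intro) fact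
  note [simp] = induced_map_lin[OF assms] linD(3-5)[OF assms(3)] Q.add_Q Q'.add_Q Q.smult_Q Q'.smult_Q
    Q.carrier_Q Q'.carrier_Q vspace_smult(1)[OF Q.vs]
  show ?thesis by (rule linI[OF Q.vspace_Q Q'.vspace_Q]) auto
qed

section \<open>Cohomology\<close>

locale complexes =
  fixes C :: "'a cochain"
  assumes complex: "cochain_complex C"
begin

lemma lin_diff: "lin (obj C k) (obj C (k + 1)) (diff C k)"
  using complex unfolding cochain_complex_def by blast

text \<open>
  Coboundaries are indexed by \<open>k - 1\<close>; this instance has codomain in degree \<open>k\<close> rather than
  \<open>k - 1 + 1\<close>.
\<close>
lemma lin_diff': "lin (obj C (k - 1)) (obj C k) (diff C (k - 1))"
  using lin_diff[of "k - 1"] by simp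

lemma vs: "vspace (obj C k)"
  by (rule linD(1)[OF lin_diff])

sublocale O: abelian_group "obj C k" for k
  by (rule vspace_abelian_group[OF vs])

lemma diff_diff: "x \<in> carrier (obj C k) \<Longrightarrow> diff C (k + 1) (diff C k x) = \<zero>\<^bsub>obj C (k + 1 + 1)\<^esub>"
  using complex unfolding cochain_complex_def by (simp add: add.assoc)

lemma cocycles_iff:
  "x \<in> cocycles C k \<longleftrightarrow> x \<in> carrier (obj C k) \<and> diff C k x = \<zero>\<^bsub>obj C (k + 1)\<^esub>"
  by (simp add: cocycles_def a_kernel_iff)

lemma diff_cocycles: "x \<in> carrier (obj C k) \<Longrightarrow> diff C k x \<in> cocycles C (k + 1)"
  using diff_diff linD(3)[OF lin_diff] by (simp add: cocycles_iff)

lemma subsp_cocycles: "subsp (obj C k) (cocycles C k)"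
  unfolding cocycles_def by (rule subsp_kernel[OF lin_diff])

lemma subsp_coboundaries: "subsp (obj C k) (coboundaries C k)"
  unfolding coboundaries_def by (rule subsp_image[OF lin_diff'])

lemma coboundaries_cocycles: "coboundaries C k \<subseteq> cocycles C k"
  using diff_cocycles[of _ "k - 1"] by (auto simp: coboundaries_def)

sublocale H: quotient "(obj C k)\<lparr>carrier := cocycles C k\<rparr>" "coboundaries C k" for k
  by (rule quotient.intro)
    (rule subsp_restrict[OF subsp_cocycles coboundaries_cocycles subsp_coboundaries])

abbreviation hclass :: "int \<Rightarrow> 'a \<Rightarrow> 'a set" where "hclass \<equiv> cohomology_class C"

lemma mem_hclass:
  "x \<in> hclass k y \<longleftrightarrow> (\<exists>b\<in>carrier (obj C (k - 1)). x = diff C (k - 1) b \<oplus>\<^bsub>obj C k\<^esub> y)"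
  by (auto simp: cohomology_class_def coset_mem coboundaries_def)

lemma hclass_self: "x \<in> cocycles C k \<Longrightarrow> x \<in> hclass k x"
  using H.cls_self[of x k] by (simp add: cohomology_class_def)

lemma hclass_cocycles: "x \<in> hclass k y \<Longrightarrow> y \<in> cocycles C k \<Longrightarrow> x \<in> cocycles C k"
  unfolding cohomology_class_def coset_mem
  using coboundaries_cocycles subspD(4)[OF subsp_cocycles] by blast

lemma hclass_eqI: "x \<in> hclass k y \<Longrightarrow> y \<in> cocycles C k \<Longrightarrow> hclass k x = hclass k y"
  using H.cls_eqI[of x k y] by (simp add: cohomology_class_def)

lemma carrier_cohomology: "carrier (cohomology C k) = hclass k ` cocycles C k"
  using H.carrier_Q[of k] by (simp add: cohomology_def cohomology_class_def)

lemma zero_cohomology: "\<zero>\<^bsub>cohomology C k\<^esub> = hclass k \<zero>\<^bsub>obj C k\<^esub>"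
  using H.cls_zero[of k] H.zero_Q[of k] by (simp add: cohomology_def cohomology_class_def)

lemma hclass_eq_zero_iff:
  assumes "x \<in> cocycles C k"
  shows "hclass k x = \<zero>\<^bsub>cohomology C k\<^esub> \<longleftrightarrow> (\<exists>b\<in>carrier (obj C (k - 1)). x = diff C (k - 1) b)"
  using H.cls_eq_zero_iff[of x k] assms H.zero_Q[of k]
  by (auto simp: cohomology_def cohomology_class_def coboundaries_def)

lemma add_cohomology:
  "x \<in> cocycles C k \<Longrightarrow> y \<in> cocycles C k \<Longrightarrow>
    hclass k x \<oplus>\<^bsub>cohomology C k\<^esub> hclass k y = hclass k (x \<oplus>\<^bsub>obj C k\<^esub> y)"
  using H.add_Q[of x k y] by (simp add: cohomology_def cohomology_class_def)

lemma smult_cohomology: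
  "x \<in> cocycles C k \<Longrightarrow> c \<odot>\<^bsub>cohomology C k\<^esub> hclass k x = hclass k (c \<odot>\<^bsub>obj C k\<^esub> x)"
  using H.smult_Q[of x k c] by (simp add: cohomology_def cohomology_class_def)

lemma vspace_cohomology: "vspace (cohomology C k)"
  unfolding cohomology_def by (rule H.vspace_Q)

lemma minus_cohomology:
  assumes "x \<in> cocycles C k" "y \<in> cocycles C k"
  shows "hclass k x \<ominus>\<^bsub>cohomology C k\<^esub> hclass k y = hclass k (x \<ominus>\<^bsub>obj C k\<^esub> y)"
  using assms subspD(5)[OF subsp_cocycles assms(2), of "- 1"]
  by (simp add: a_minus_smult[OF vspace_cohomology] a_minus_smult[OF vs] carrier_cohomology smult_cohomology
      add_cohomology cocycles_iff)

end

locale chain_maps = C: complexes C + D: complexes D for C :: "'a cochain" and D :: "'b cochain" +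
  fixes f :: "int \<Rightarrow> 'a \<Rightarrow> 'b"
  assumes chain: "chain_map C D f"
begin

lemma lin_map: "lin (obj C k) (obj D k) (f k)"
  using chain unfolding chain_map_def by blast

lemma map_diff: "x \<in> carrier (obj C k) \<Longrightarrow> f (k + 1) (diff C k x) = diff D k (f k x)"
  using chain unfolding chain_map_def by blast

lemma map_diff':
  "x \<in> carrier (obj C (k - 1)) \<Longrightarrow> f k (diff C (k - 1) x) = diff D (k - 1) (f (k - 1) x)"
  using map_diff[of x "k - 1"] by simp

lemma map_cocycles: "x \<in> cocycles C k \<Longrightarrow> f k x \<in> cocycles D k"
  using map_diff[of x k] linD(3,6)[OF lin_map]
  by (auto simp: C.cocycles_iff D.cocycles_iff)

lemma map_coboundaries: "f k ` coboundaries C k \<subseteq> coboundaries D k"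
  using map_diff'[of _ k] linD(3)[OF lin_map[of "k - 1"]] by (auto simp: coboundaries_def)

lemma lin_cocycles:
  "lin ((obj C k)\<lparr>carrier := cocycles C k\<rparr>) ((obj D k)\<lparr>carrier := cocycles D k\<rparr>) (f k)"
  using linD(3-5)[OF lin_map] map_cocycles
  by (intro linI[OF C.H.vs D.H.vs]) (auto simp: C.cocycles_iff)

lemma cohomology_map_hclass:
  "x \<in> cocycles C k \<Longrightarrow> cohomology_map D f k (cohomology_class C k x) = cohomology_class D k (f k x)"
  using induced_map_lin[OF C.H.sub D.H.sub lin_cocycles map_coboundaries, of x]
  by (simp add: cohomology_map_def cohomology_class_def induced_map_def)

lemma lin_cohomology_map: "lin (cohomology C k) (cohomology D k) (cohomology_map D f k)"
  using lin_induced_map[OF C.H.sub D.H.sub lin_cocycles map_coboundaries, of k]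
  by (simp add: cohomology_map_def cohomology_def induced_map_def[abs_def])

end

section \<open>The long exact sequence of a short exact sequence of complexes\<close>

locale short_exact =
  fixes C :: "'a cochain" and D :: "'b cochain" and E :: "'c cochain" and f g
  assumes ses: "short_exact_complexes C D E f g"
begin

sublocale C: complexes C + D: complexes D + E: complexes E + f: chain_maps C D f + g: chain_maps D E g
  using ses unfolding short_exact_complexes_def
  by (auto simp: complexes_def chain_maps_def chain_maps_axioms_def)

lemma inj_f: "x \<in> carrier (obj C k) \<Longrightarrow> y \<in> carrier (obj C k) \<Longrightarrow> f k x = f k y \<Longrightarrow> x = y"
  using ses unfolding short_exact_complexes_def inj_on_def by blast

lemma g_eq_zero_iff:
  "b \<in> carrier (obj D k) \<Longrightarrow> g k b = \<zero>\<^bsub>obj E k\<^esub> \<longleftrightarrow> (\<exists>x\<in>carrier (obj C k). b = f k x)"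
  using ses unfolding short_exact_complexes_def exact_at_def by (auto simp: a_kernel_iff set_eq_iff image_iff)

lemma g_f: "x \<in> carrier (obj C k) \<Longrightarrow> g k (f k x) = \<zero>\<^bsub>obj E k\<^esub>"
  using g_eq_zero_iff[of "f k x" k] linD(3)[OF f.lin_map] by blast

lemma surj_g: "e \<in> carrier (obj E k) \<Longrightarrow> \<exists>b\<in>carrier (obj D k). g k b = e"
  using ses unfolding short_exact_complexes_def by (metis imageE)

text \<open>Injectivity of \<open>f\<close> in degree \<open>k + 1\<close> lets cocycles be detected in \<open>D\<close>.\<close>
lemma f_cocycle_iff: "x \<in> carrier (obj C k) \<Longrightarrow> f k x \<in> cocycles D k \<longleftrightarrow> x \<in> cocycles C k"
  using f.map_diff[of x k] inj_f[of "diff C k x" "k + 1" "\<zero>\<^bsub>obj C (k + 1)\<^esub>"] linD(6)[OF f.lin_map, of "k + 1"]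
    linD(3)[OF C.lin_diff, of x k] linD(3)[OF f.lin_map, of x k]
  by (auto simp: C.cocycles_iff D.cocycles_iff)

abbreviation \<delta> where "\<delta> \<equiv> connecting_map C D f g"

text \<open>
  One instance of the diagram chase behind \<open>\<delta>\<close>: \<open>b\<close> lifts the cocycle \<open>g b\<close> of \<open>E\<close>, and \<open>x\<close> is the
  preimage of \<open>d b\<close> in \<open>C\<close>. Computing \<open>\<delta>\<close> on a class only needs some pair of this kind.
\<close>
definition zigzag :: "int \<Rightarrow> 'b \<Rightarrow> 'a \<Rightarrow> bool" where
  "zigzag k b x \<longleftrightarrow> b \<in> carrier (obj D k) \<and> x \<in> carrier (obj C (k + 1)) \<and> f (k + 1) x = diff D k b"

lemma zigzag_cocycles:
  assumes "zigzag k b x"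
  shows "g k b \<in> cocycles E k" "x \<in> cocycles C (k + 1)"
proof -
  have b: "b \<in> carrier (obj D k)" "x \<in> carrier (obj C (k + 1))" "f (k + 1) x = diff D k b"
    using assms by (auto simp: zigzag_def)
  show "x \<in> cocycles C (k + 1)"
    using f_cocycle_iff[OF b(2)] D.diff_cocycles[OF b(1)] b(3) by simp
  show "g k b \<in> cocycles E k"
    using g.map_diff[OF b(1)] g_f[OF b(2)] b(3) linD(3)[OF g.lin_map b(1)] by (simp add: E.cocycles_iff)
qed

lemma zigzag_exists:
  assumes "e \<in> cocycles E k"
  obtains b x where "zigzag k b x" "g k b = e"
proof -
  obtain b where b: "b \<in> carrier (obj D k)" "g k b = e"
    using surj_g assms by (auto simp: E.cocycles_iff)
  have "g (k + 1) (diff D k b) = \<zero>\<^bsub>obj E (k + 1)\<^esub>"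
    using g.map_diff[OF b(1)] b(2) assms by (simp add: E.cocycles_iff)
  then obtain x where "x \<in> carrier (obj C (k + 1))" "diff D k b = f (k + 1) x"
    using g_eq_zero_iff[of "diff D k b" "k + 1"] linD(3)[OF D.lin_diff b(1)] by auto
  then show thesis using b that[of b x] by (simp add: zigzag_def)
qed

text \<open>
  Two lifts of the same class differ by a coboundary of \<open>D\<close>, which \<open>d\<close> kills, and by an element \<open>f c\<close>,
  which changes \<open>x\<close> by the coboundary \<open>d c\<close>.
\<close>
lemma zigzag_unique:
  assumes z: "zigzag k b x" and z': "zigzag k b' x'" and e: "g k b' \<in> cohomology_class E k (g k b)"
  shows "cohomology_class C (k + 1) x' = cohomology_class C (k + 1) x"
proof -
  have b: "b \<in> carrier (obj D k)" "x \<in> carrier (obj C (k + 1))" "f (k + 1) x = diff D k b"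
    using z by (auto simp: zigzag_def)
  have b': "b' \<in> carrier (obj D k)" "x' \<in> carrier (obj C (k + 1))" "f (k + 1) x' = diff D k b'"
    using z' by (auto simp: zigzag_def)
  note [simp] = linD(3)[OF D.lin_diff] linD(3)[OF D.lin_diff'] linD(3)[OF C.lin_diff] linD(3)[OF f.lin_map]
    linD(3)[OF g.lin_map] linD(3)[OF E.lin_diff']
  obtain e'' where e'': "e'' \<in> carrier (obj E (k - 1))" "g k b' = diff E (k - 1) e'' \<oplus>\<^bsub>obj E k\<^esub> g k b"
    using e by (auto simp: E.mem_hclass)
  obtain b'' where b'': "b'' \<in> carrier (obj D (k - 1))" "g (k - 1) b'' = e''"
    using surj_g[OF e''(1)] by auto
  \<comment> \<open>\<open>a\<close> is \<open>b\<close> corrected by a coboundary so that \<open>a\<close> and \<open>b'\<close> have the same image under \<open>g\<close>\<close>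
  define a where "a = diff D (k - 1) b'' \<oplus>\<^bsub>obj D k\<^esub> b"
  have a: "a \<in> carrier (obj D k)" using b b'' by (simp add: a_def)
  have ga: "g k a = g k b'"
    using b b'' e'' g.map_diff'[OF b''(1)] by (simp add: a_def linD(4)[OF g.lin_map])
  have da: "diff D k a = diff D k b"
    using b b'' D.diff_diff[OF b''(1)] by (simp add: a_def linD(4)[OF D.lin_diff])
  have "g k (b' \<ominus>\<^bsub>obj D k\<^esub> a) = \<zero>\<^bsub>obj E k\<^esub>"
    using a b' ga by (simp add: linD(8)[OF g.lin_map])
  then obtain c where c: "c \<in> carrier (obj C k)" "b' \<ominus>\<^bsub>obj D k\<^esub> a = f k c"
    using g_eq_zero_iff[of "b' \<ominus>\<^bsub>obj D k\<^esub> a" k] a b' by auto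
  have "f (k + 1) x' = diff D k (b' \<ominus>\<^bsub>obj D k\<^esub> a) \<oplus>\<^bsub>obj D (k + 1)\<^esub> diff D k a"
    using a b' by (simp add: linD(4,7)[OF D.lin_diff] a_minus_def D.O.a_assoc D.O.l_neg)
  also have "\<dots> = f (k + 1) (diff C k c \<oplus>\<^bsub>obj C (k + 1)\<^esub> x)"
    using c b da f.map_diff[OF c(1)] by (simp add: linD(4)[OF f.lin_map])
  finally have "x' = diff C k c \<oplus>\<^bsub>obj C (k + 1)\<^esub> x"
    using c b b' by (intro inj_f[of x' "k + 1"]) auto
  then show ?thesis
    using c zigzag_cocycles[OF z] by (intro C.hclass_eqI) (auto simp: C.mem_hclass)
qed

lemma connecting_map_hclass:
  assumes z: "zigzag k b x"
  shows "\<delta> k (cohomology_class E k (g k b)) = cohomology_class C (k + 1) x"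
proof -
  let ?A = "{cohomology_class C (k + 1) x' | x' b'. x' \<in> carrier (obj C (k + 1)) \<and> b' \<in> carrier (obj D k) \<and>
        g k b' \<in> cohomology_class E k (g k b) \<and> f (k + 1) x' = diff D k b'}"
  have "?A \<subseteq> {cohomology_class C (k + 1) x}"
    using zigzag_unique[OF z] by (auto simp: zigzag_def)
  moreover have "cohomology_class C (k + 1) x \<in> ?A"
    using z E.hclass_self[OF zigzag_cocycles(1)[OF z]] by (auto simp: zigzag_def)
  ultimately have "?A = {cohomology_class C (k + 1) x}" by blast
  then show ?thesis by (simp add: connecting_map_def)
qed

lemma zigzag_add:
  "zigzag k b x \<Longrightarrow> zigzag k b' x' \<Longrightarrow> zigzag k (b \<oplus>\<^bsub>obj D k\<^esub> b') (x \<oplus>\<^bsub>obj C (k + 1)\<^esub> x')"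
  by (auto simp: zigzag_def linD(4)[OF f.lin_map] linD(4)[OF D.lin_diff])

lemma zigzag_smult:
  "zigzag k b x \<Longrightarrow> zigzag k (c \<odot>\<^bsub>obj D k\<^esub> b) (c \<odot>\<^bsub>obj C (k + 1)\<^esub> x)"
  by (auto simp: zigzag_def linD(5)[OF f.lin_map] linD(5)[OF D.lin_diff] vspace_smult(1)[OF C.vs]
      vspace_smult(1)[OF D.vs])

lemma cohomology_E_cases:
  assumes "Z \<in> carrier (cohomology E k)"
  obtains b x where "zigzag k b x" "Z = cohomology_class E k (g k b)"
  using assms zigzag_exists unfolding E.carrier_cohomology by (metis imageE)

lemma lin_connecting_map: "lin (cohomology E k) (cohomology C (k + 1)) (\<delta> k)"
proof (rule linI[OF E.vspace_cohomology C.vspace_cohomology])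
  fix Z assume "Z \<in> carrier (cohomology E k)"
  then obtain b x where z: "zigzag k b x" "Z = cohomology_class E k (g k b)" by (rule cohomology_E_cases)
  have bx: "b \<in> carrier (obj D k)" "x \<in> cocycles C (k + 1)" "g k b \<in> cocycles E k"
    using z(1) zigzag_cocycles[OF z(1)] by (auto simp: zigzag_def)
  show "\<delta> k Z \<in> carrier (cohomology C (k + 1))"
    using bx connecting_map_hclass[OF z(1)] z(2) by (auto simp: C.carrier_cohomology)
  show "\<delta> k (c \<odot>\<^bsub>cohomology E k\<^esub> Z) = c \<odot>\<^bsub>cohomology C (k + 1)\<^esub> \<delta> k Z" for c
    using bx connecting_map_hclass[OF z(1)] z(2) connecting_map_hclass[OF zigzag_smult[OF z(1), of c]]
      linD(5)[OF g.lin_map bx(1)]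
    by (simp add: C.smult_cohomology E.smult_cohomology)
  fix Z' assume "Z' \<in> carrier (cohomology E k)"
  then obtain b' x' where z': "zigzag k b' x'" "Z' = cohomology_class E k (g k b')" by (rule cohomology_E_cases)
  have bx': "b' \<in> carrier (obj D k)" "x' \<in> cocycles C (k + 1)" "g k b' \<in> cocycles E k"
    using z'(1) zigzag_cocycles[OF z'(1)] by (auto simp: zigzag_def)
  show "\<delta> k (Z \<oplus>\<^bsub>cohomology E k\<^esub> Z') = \<delta> k Z \<oplus>\<^bsub>cohomology C (k + 1)\<^esub> \<delta> k Z'"
    using bx bx' z(2) z'(2) connecting_map_hclass[OF z(1)] connecting_map_hclass[OF z'(1)]
      connecting_map_hclass[OF zigzag_add[OF z(1) z'(1)]] linD(4)[OF g.lin_map bx(1) bx'(1)]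
    by (simp add: C.add_cohomology E.add_cohomology)
qed

text \<open>
  If \<open>g b\<close> is the coboundary of \<open>e\<close> and \<open>a\<close> lifts \<open>e\<close>, then \<open>b - d a\<close> represents the class of \<open>b\<close> and
  lies in the kernel of \<open>g\<close>, hence in the image of \<open>f\<close>.
\<close>
lemma exact_at_D:
  "exact_at (cohomology C k) (cohomology D k) (cohomology E k) (cohomology_map D f k) (cohomology_map E g k)"
proof -
  note [simp] = linD(3)[OF D.lin_diff] linD(3)[OF D.lin_diff'] linD(3)[OF f.lin_map]
    linD(3)[OF g.lin_map] linD(3)[OF E.lin_diff']
  show ?thesis unfolding exact_at_def
  proof (intro equalityI subsetI)
    fix Y assume "Y \<in> cohomology_map D f k ` carrier (cohomology C k)"
    then obtain x where x: "x \<in> cocycles C k" "Y = cohomology_class D k (f k x)"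
      by (auto simp: C.carrier_cohomology f.cohomology_map_hclass)
    then have "cohomology_map E g k Y = \<zero>\<^bsub>cohomology E k\<^esub>"
      using f.map_cocycles g_f[of x k]
      by (simp add: g.cohomology_map_hclass E.zero_cohomology C.cocycles_iff)
    then show "Y \<in> a_kernel (cohomology D k) (cohomology E k) (cohomology_map E g k)"
      using x f.map_cocycles by (auto simp: a_kernel_iff D.carrier_cohomology)
  next
    fix Y assume "Y \<in> a_kernel (cohomology D k) (cohomology E k) (cohomology_map E g k)"
    then obtain b where b: "b \<in> cocycles D k" "Y = cohomology_class D k b"
      and "cohomology_class E k (g k b) = \<zero>\<^bsub>cohomology E k\<^esub>"
      by (auto simp: a_kernel_iff D.carrier_cohomology g.cohomology_map_hclass)
    then obtain e where e: "e \<in> carrier (obj E (k - 1))" "g k b = diff E (k - 1) e"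
      using E.hclass_eq_zero_iff g.map_cocycles by auto
    obtain a where a: "a \<in> carrier (obj D (k - 1))" "g (k - 1) a = e"
      using surj_g[OF e(1)] by auto
    have bc: "b \<in> carrier (obj D k)" using b by (simp add: D.cocycles_iff)
    let ?b = "b \<ominus>\<^bsub>obj D k\<^esub> diff D (k - 1) a"
    have "g k ?b = \<zero>\<^bsub>obj E k\<^esub>"
      using bc a e g.map_diff'[OF a(1)] by (simp add: linD(8)[OF g.lin_map])
    then obtain x where x: "x \<in> carrier (obj C k)" "?b = f k x"
      using g_eq_zero_iff[of ?b k] bc a by auto
    have da: "diff D (k - 1) a \<in> cocycles D k" using D.diff_cocycles[OF a(1)] by simp
    have fx: "f k x \<in> cocycles D k"
      using subspD(8)[OF D.subsp_cocycles b(1) da] x by simp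
    then have xc: "x \<in> cocycles C k" using f_cocycle_iff[OF x(1)] by simp
    have "b = diff D (k - 1) a \<oplus>\<^bsub>obj D k\<^esub> f k x"
      using bc a by (simp add: x(2)[symmetric] a_minus_def D.O.a_ac D.O.r_neg)
    then have "Y = cohomology_class D k (f k x)"
      using fx b a by (intro trans[OF b(2) D.hclass_eqI]) (auto simp: D.mem_hclass)
    then show "Y \<in> cohomology_map D f k ` carrier (cohomology C k)"
      using xc by (auto simp: C.carrier_cohomology f.cohomology_map_hclass intro!: image_eqI)
  qed
qed

text \<open>
  If the connecting class \<open>[x]\<close> vanishes, say \<open>x = d c\<close>, then \<open>b - f c\<close> is a cocycle of \<open>D\<close> with the
  same image under \<open>g\<close> as \<open>b\<close>.
\<close>
lemma exact_at_E:
  "exact_at (cohomology D k) (cohomology E k) (cohomology C (k + 1)) (cohomology_map E g k) (\<delta> k)"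
  unfolding exact_at_def
proof (intro equalityI subsetI)
  fix Z assume "Z \<in> cohomology_map E g k ` carrier (cohomology D k)"
  then obtain b where b: "b \<in> cocycles D k" "Z = cohomology_class E k (g k b)"
    by (auto simp: D.carrier_cohomology g.cohomology_map_hclass)
  then have "zigzag k b \<zero>\<^bsub>obj C (k + 1)\<^esub>"
    using linD(6)[OF f.lin_map] by (simp add: zigzag_def D.cocycles_iff)
  then show "Z \<in> a_kernel (cohomology E k) (cohomology C (k + 1)) (\<delta> k)"
    using connecting_map_hclass b g.map_cocycles[OF b(1)]
    by (simp add: a_kernel_iff C.zero_cohomology E.carrier_cohomology)
next
  note [simp] = linD(3)[OF D.lin_diff] linD(3)[OF f.lin_map]
  fix Z assume Z: "Z \<in> a_kernel (cohomology E k) (cohomology C (k + 1)) (\<delta> k)"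
  then have "Z \<in> carrier (cohomology E k)" by (simp add: a_kernel_iff)
  then obtain b x where z: "zigzag k b x" "Z = cohomology_class E k (g k b)" by (rule cohomology_E_cases)
  have b: "b \<in> carrier (obj D k)" "f (k + 1) x = diff D k b" "x \<in> cocycles C (k + 1)"
    using z(1) zigzag_cocycles[OF z(1)] by (auto simp: zigzag_def)
  have "cohomology_class C (k + 1) x = \<zero>\<^bsub>cohomology C (k + 1)\<^esub>"
    using Z connecting_map_hclass[OF z(1)] z(2) by (simp add: a_kernel_iff)
  then obtain c where c: "c \<in> carrier (obj C k)" "x = diff C k c"
    using C.hclass_eq_zero_iff[OF b(3)] by auto
  let ?b = "b \<ominus>\<^bsub>obj D k\<^esub> f k c"
  have "diff D k ?b = \<zero>\<^bsub>obj D (k + 1)\<^esub>"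
    using b c f.map_diff[OF c(1)] by (simp add: linD(8)[OF D.lin_diff])
  then have bc: "?b \<in> cocycles D k"
    using b c by (simp add: D.cocycles_iff)
  have "g k ?b = g k b"
    using b c g_f[OF c(1)] linD(3)[OF g.lin_map b(1)] by (simp add: linD(4,7)[OF g.lin_map] a_minus_def)
  then have "Z = cohomology_map E g k (cohomology_class D k ?b)"
    using z(2) g.cohomology_map_hclass[OF bc] by simp
  then show "Z \<in> cohomology_map E g k ` carrier (cohomology D k)"
    using bc by (auto simp: D.carrier_cohomology)
qed

text \<open>
  A class \<open>[x]\<close> dies in \<open>D\<close> exactly when \<open>f x = d b\<close> for some \<open>b\<close>, which says that \<open>x\<close> ends a zigzag
  starting at \<open>b\<close>.
\<close>
lemma exact_at_C:
  "exact_at (cohomology E k) (cohomology C (k + 1)) (cohomology D (k + 1)) (\<delta> k) (cohomology_map D f (k + 1))"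
  unfolding exact_at_def
proof (intro equalityI subsetI)
  fix Y assume "Y \<in> \<delta> k ` carrier (cohomology E k)"
  then obtain Z where "Z \<in> carrier (cohomology E k)" "Y = \<delta> k Z" by auto
  then obtain b x where z: "zigzag k b x" "Y = cohomology_class C (k + 1) x"
    using connecting_map_hclass by (metis cohomology_E_cases)
  have x: "x \<in> cocycles C (k + 1)" by (rule zigzag_cocycles(2)[OF z(1)])
  have "cohomology_class D (k + 1) (f (k + 1) x) = \<zero>\<^bsub>cohomology D (k + 1)\<^esub>"
    using z(1) D.hclass_eq_zero_iff[OF f.map_cocycles[OF x]] by (auto simp: zigzag_def)
  then show "Y \<in> a_kernel (cohomology C (k + 1)) (cohomology D (k + 1)) (cohomology_map D f (k + 1))"
    using x z(2) by (simp add: a_kernel_iff C.carrier_cohomology f.cohomology_map_hclass)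
next
  fix Y assume "Y \<in> a_kernel (cohomology C (k + 1)) (cohomology D (k + 1)) (cohomology_map D f (k + 1))"
  then obtain x where x: "x \<in> cocycles C (k + 1)" "Y = cohomology_class C (k + 1) x"
    and "cohomology_class D (k + 1) (f (k + 1) x) = \<zero>\<^bsub>cohomology D (k + 1)\<^esub>"
    by (auto simp: a_kernel_iff C.carrier_cohomology f.cohomology_map_hclass)
  then obtain b where b: "b \<in> carrier (obj D k)" "f (k + 1) x = diff D k b"
    using D.hclass_eq_zero_iff[OF f.map_cocycles[OF x(1)]] by auto
  then have z: "zigzag k b x" using x by (simp add: zigzag_def C.cocycles_iff)
  have "cohomology_class E k (g k b) \<in> carrier (cohomology E k)"
    using zigzag_cocycles(1)[OF z] by (simp add: E.carrier_cohomology)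
  then show "Y \<in> \<delta> k ` carrier (cohomology E k)"
    using connecting_map_hclass[OF z] x(2) by (intro image_eqI) auto
qed

lemma long_exact:
  "long_exact_sequence (cohomology C) (cohomology D) (cohomology E) (cohomology_map D f) (cohomology_map E g) \<delta>"
  unfolding long_exact_sequence_def
  using f.lin_cohomology_map g.lin_cohomology_map lin_connecting_map exact_at_C exact_at_D exact_at_E by blast

end

section \<open>Total degree and relations in a bicomplex\<close>

context bicomplex
begin

abbreviation A where "A \<equiv> ambient X"

lemma vs: "vspace A" by (rule vectorspace_ambient)

sublocale A: abelian_group "ambient X" by (rule vspace_abelian_group[OF vs])

lemmas smultA = vspace_smult[OF vs]

lemma minus_zeroA: "\<ominus>\<^bsub>A\<^esub> \<zero>\<^bsub>A\<^esub> = \<zero>\<^bsub>A\<^esub>"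
  by (rule A.minus_equality) auto

lemma piece_carrier: "x \<in> piece X p q \<Longrightarrow> x \<in> carrier A"
  by (rule subspD(6)[OF subspace_piece])

lemma lin_finsum:
  assumes "lin A A f" "finite S" "c \<in> S \<rightarrow> carrier A"
  shows "f (finsum A c S) = finsum A (\<lambda>p. f (c p)) S"
  using assms(2,3)
proof (induction S rule: finite_induct)
  case empty
  then show ?case using linD(6)[OF assms(1)] by simp
next
  case (insert p S)
  then show ?case
    using linD(3,4)[OF assms(1)] by (simp add: Pi_iff A.finsum_insert A.finsum_closed)
qed

text \<open>
  The direct sum property in the form used below. The family is indexed by an arbitrary finite set
  with distinct bidegrees, so that the lemma covers both a sum over bidegrees of fixed total degree
  and a sum of three terms.
\<close>
lemma components_zero:
  fixes \<beta> :: "'b \<Rightarrow> int \<times> int"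
  assumes fin: "finite I" and inj: "inj_on \<beta> I"
    and x: "\<And>i. i \<in> I \<Longrightarrow> x i \<in> piece X (fst (\<beta> i)) (snd (\<beta> i))"
    and sum: "finsum A x I = \<zero>\<^bsub>A\<^esub>" and i: "i \<in> I"
  shows "x i = \<zero>\<^bsub>A\<^esub>"
proof -
  define c where "c p q = (if (p, q) \<in> \<beta> ` I then x (the_inv_into I \<beta> (p, q)) else \<zero>\<^bsub>A\<^esub>)" for p q
  have c\<beta>: "(case \<beta> j of (p, q) \<Rightarrow> c p q) = x j" if "j \<in> I" for j
    using that the_inv_into_f_f[OF inj that] by (cases "\<beta> j") (auto simp: c_def intro: image_eqI[OF sym])
  have mem: "c p q \<in> piece X p q" for p q
  proof (cases "(p, q) \<in> \<beta> ` I")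
    case True
    then obtain j where j: "j \<in> I" "(p, q) = \<beta> j" by auto
    show ?thesis using c\<beta>[OF j(1)] x[OF j(1)] by (simp add: j(2)[symmetric])
  next
    case False
    then show ?thesis using subspD(3)[OF subspace_piece] by (simp add: c_def)
  qed
  have memA: "c p q \<in> carrier A" for p q using mem piece_carrier by blast
  let ?S = "{(p, q). c p q \<noteq> \<zero>\<^bsub>A\<^esub>}"
  have sub: "?S \<subseteq> \<beta> ` I" by (auto simp: c_def split: if_splits)
  have fin': "finite (\<beta> ` I)" using fin by simp
  have "finsum A (\<lambda>(p, q). c p q) ?S = finsum A (\<lambda>(p, q). c p q) (\<beta> ` I)"
    using sub fin' memA by (intro A.add.finprod_mono_neutral_cong_left) auto
  also have "\<dots> = finsum A (\<lambda>j. case \<beta> j of (p, q) \<Rightarrow> c p q) I"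
    using memA by (intro A.finsum_reindex inj) auto
  also have "\<dots> = finsum A x I"
    using x piece_carrier c\<beta> by (intro A.finsum_cong') auto
  finally have c_sum: "\<zero>\<^bsub>A\<^esub> = finsum A (\<lambda>(p, q). c p q) ?S" using sum by simp
  define P where "P c \<longleftrightarrow> (\<forall>p q. c p q \<in> piece X p q) \<and> finite {(p, q). c p q \<noteq> \<zero>\<^bsub>A\<^esub>} \<and>
           \<zero>\<^bsub>A\<^esub> = finsum A (\<lambda>(p, q). c p q) {(p, q). c p q \<noteq> \<zero>\<^bsub>A\<^esub>}" for c
  have "P c"
    using mem c_sum finite_subset[OF sub fin'] by (simp add: P_def)
  moreover have "P (\<lambda>p q. \<zero>\<^bsub>A\<^esub>)"
    using subspD(3)[OF subspace_piece] by (simp add: P_def)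
  moreover have "\<exists>!c. P c"
    unfolding P_def by (rule direct_sum_pieces) simp
  ultimately have "c = (\<lambda>p q. \<zero>\<^bsub>A\<^esub>)" unfolding Ex1_def by metis
  then show ?thesis using c\<beta>[OF i] by (simp add: case_prod_beta)
qed

lemma linA:
  "x \<in> carrier A \<Longrightarrow> del X x \<in> carrier A" "x \<in> carrier A \<Longrightarrow> delbar X x \<in> carrier A"
  "x \<in> carrier A \<Longrightarrow> y \<in> carrier A \<Longrightarrow> del X (x \<oplus>\<^bsub>A\<^esub> y) = del X x \<oplus>\<^bsub>A\<^esub> del X y"
  "x \<in> carrier A \<Longrightarrow> y \<in> carrier A \<Longrightarrow> delbar X (x \<oplus>\<^bsub>A\<^esub> y) = delbar X x \<oplus>\<^bsub>A\<^esub> delbar X y"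
  "x \<in> carrier A \<Longrightarrow> del X (c \<odot>\<^bsub>A\<^esub> x) = c \<odot>\<^bsub>A\<^esub> del X x"
  "x \<in> carrier A \<Longrightarrow> delbar X (c \<odot>\<^bsub>A\<^esub> x) = c \<odot>\<^bsub>A\<^esub> delbar X x"
  "x \<in> carrier A \<Longrightarrow> del X (\<ominus>\<^bsub>A\<^esub> x) = \<ominus>\<^bsub>A\<^esub> del X x"
  "x \<in> carrier A \<Longrightarrow> delbar X (\<ominus>\<^bsub>A\<^esub> x) = \<ominus>\<^bsub>A\<^esub> delbar X x"
  "del X \<zero>\<^bsub>A\<^esub> = \<zero>\<^bsub>A\<^esub>" "delbar X \<zero>\<^bsub>A\<^esub> = \<zero>\<^bsub>A\<^esub>"
  using linD(3-7)[OF linear_del] linD(3-7)[OF linear_delbar] by auto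

lemma lin_dtot: "lin A A (dtot X)"
  by (rule linI[OF vs vs]) (auto simp: dtot_def linA A.a_ac smultA)

lemma lin_dc: "lin A A (dc X)"
proof (rule linI[OF vs vs])
  fix c x assume "x \<in> carrier A"
  then show "dc X (c \<odot>\<^bsub>A\<^esub> x) = c \<odot>\<^bsub>A\<^esub> dc X x"
    using linD(8)[OF lin_smult[OF vs, of c], of "delbar X x" "del X x"]
      linD(5)[OF lin_smult[OF vs, of c], of "delbar X x \<ominus>\<^bsub>A\<^esub> del X x" \<i>]
    by (simp add: dc_def linA)
qed (auto simp: dc_def linA A.a_ac smultA a_minus_def A.minus_add)

lemma tot_simps [simp]: "add (tot X k) = add A" "zero (tot X k) = \<zero>\<^bsub>A\<^esub>" "smult (tot X k) = smult A"
  by (auto simp: tot_def)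

lemma finsum_tot:
  "finite S \<Longrightarrow> (\<And>p. p \<in> S \<Longrightarrow> c p \<in> piece X p (k - p)) \<Longrightarrow> finsum A c S \<in> carrier (tot X k)"
  by (auto simp: tot_def)

text \<open>
  Extending the components by zero makes them available in every bidegree, so that they can be
  shifted without case distinctions.
\<close>
lemma carrier_tot_iff:
  "x \<in> carrier (tot X k) \<longleftrightarrow>
    (\<exists>c S. finite S \<and> (\<forall>p. c p \<in> piece X p (k - p)) \<and> (\<forall>p. p \<notin> S \<longrightarrow> c p = \<zero>\<^bsub>A\<^esub>) \<and> x = finsum A c S)"
  (is "_ \<longleftrightarrow> ?R")
proof
  assume "x \<in> carrier (tot X k)"
  then obtain c S where c: "finite S" "\<forall>p\<in>S. c p \<in> piece X p (k - p)" "x = finsum A c S"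
    by (auto simp: tot_def)
  let ?c = "\<lambda>p. if p \<in> S then c p else \<zero>\<^bsub>A\<^esub>"
  have "x = finsum A ?c S"
    using c piece_carrier by (auto intro!: A.finsum_cong')
  then show ?R
    using c subspD(3)[OF subspace_piece] by (intro exI[of _ ?c] exI[of _ S]) auto
qed (auto simp: tot_def)

lemma tot_carrier: "x \<in> carrier (tot X k) \<Longrightarrow> x \<in> carrier A"
  using piece_carrier by (auto simp: tot_def intro!: A.finsum_closed)

lemma piece_tot: "x \<in> piece X p q \<Longrightarrow> p + q = k \<Longrightarrow> x \<in> carrier (tot X k)"
  unfolding tot_def
  by (auto intro!: exI[of _ "\<lambda>_. x"] exI[of _ "{p}"] simp: piece_carrier A.finsum_insert)

lemma subsp_tot: "subsp A (carrier (tot X k))"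
proof (rule subspI[OF vs])
  show "carrier (tot X k) \<subseteq> carrier A" using tot_carrier by blast
  show "\<zero>\<^bsub>A\<^esub> \<in> carrier (tot X k)"
    by (rule piece_tot[OF subspD(3)[OF subspace_piece], of 0 k]) simp
  fix x assume "x \<in> carrier (tot X k)"
  then obtain c S where c: "finite S" "\<And>p. c p \<in> piece X p (k - p)" "\<And>p. p \<notin> S \<Longrightarrow> c p = \<zero>\<^bsub>A\<^esub>"
    "x = finsum A c S" by (auto simp: carrier_tot_iff)
  have cA: "c p \<in> carrier A" for p using c(2) by (rule piece_carrier)
  have "a \<odot>\<^bsub>A\<^esub> x = finsum A (\<lambda>p. a \<odot>\<^bsub>A\<^esub> c p) S" for a
    unfolding c(4) using cA by (intro lin_finsum[OF lin_smult[OF vs] c(1)]) auto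
  then show "a \<odot>\<^bsub>A\<^esub> x \<in> carrier (tot X k)" for a
    using c(1,2) by (simp add: finsum_tot subspD(5)[OF subspace_piece])
  fix y assume "y \<in> carrier (tot X k)"
  then obtain c' S' where c': "finite S'" "\<And>p. c' p \<in> piece X p (k - p)" "\<And>p. p \<notin> S' \<Longrightarrow> c' p = \<zero>\<^bsub>A\<^esub>"
    "y = finsum A c' S'" by (auto simp: carrier_tot_iff)
  have cA': "c' p \<in> carrier A" for p using c'(2) by (rule piece_carrier)
  have "x = finsum A c (S \<union> S')" "y = finsum A c' (S \<union> S')"
    using c c' cA cA' by (auto intro!: A.add.finprod_mono_neutral_cong_left)
  then have "x \<oplus>\<^bsub>A\<^esub> y = finsum A (\<lambda>p. c p \<oplus>\<^bsub>A\<^esub> c' p) (S \<union> S')"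
    using c(1) c'(1) cA cA' by (simp add: A.finsum_addf)
  then show "x \<oplus>\<^bsub>A\<^esub> y \<in> carrier (tot X k)"
    using c(1,2) c'(1,2) by (simp add: finsum_tot subspD(4)[OF subspace_piece])
qed

lemma vspace_tot: "vspace (tot X k)"
  using subspD(9)[OF subsp_tot[of k]] by (simp add: tot_def)

lemma tot_induct [consumes 1, case_names piece add]:
  assumes "x \<in> carrier (tot X k)"
    and "\<And>p y. y \<in> piece X p (k - p) \<Longrightarrow> P y"
    and "\<And>x y. x \<in> carrier A \<Longrightarrow> y \<in> carrier A \<Longrightarrow> P x \<Longrightarrow> P y \<Longrightarrow> P (x \<oplus>\<^bsub>A\<^esub> y)"
  shows "P x"
proof -
  obtain c S where c: "finite S" "\<And>p. c p \<in> piece X p (k - p)" "x = finsum A c S"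
    using assms(1) by (auto simp: carrier_tot_iff)
  have cA: "c p \<in> carrier A" for p using c(2) by (rule piece_carrier)
  have "P (finsum A c S)"
    using c(1)
  proof (induction S rule: finite_induct)
    case empty
    then show ?case using assms(2)[OF subspD(3)[OF subspace_piece]] by simp
  next
    case (insert p S)
    then show ?case
      using cA assms(2)[OF c(2), of p] by (simp add: A.finsum_insert A.finsum_closed assms(3))
  qed
  then show ?thesis using c(3) by simp
qed

lemma del_tot: "x \<in> carrier (tot X k) \<Longrightarrow> del X x \<in> carrier (tot X (k + 1))"
  by (induction rule: tot_induct)
    (auto simp: linA intro: piece_tot[OF del_piece] subspD(4)[OF subsp_tot])

lemma delbar_tot: "x \<in> carrier (tot X k) \<Longrightarrow> delbar X x \<in> carrier (tot X (k + 1))"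
  by (induction rule: tot_induct)
    (auto simp: linA intro: piece_tot[OF delbar_piece] subspD(4)[OF subsp_tot])

lemma lin_restrict_tot:
  assumes "lin A A f" "\<And>x. x \<in> carrier (tot X k) \<Longrightarrow> f x \<in> carrier (tot X l)"
  shows "lin (tot X k) (tot X l) f"
  using assms(2) linD(4,5)[OF assms(1)] tot_carrier by (intro linI vspace_tot) auto

lemma lin_tot_dtot: "lin (tot X k) (tot X (k + 1)) (dtot X)"
  by (rule lin_restrict_tot[OF lin_dtot])
    (simp add: dtot_def subspD(4)[OF subsp_tot] del_tot delbar_tot)

lemma lin_tot_dc: "lin (tot X k) (tot X (k + 1)) (dc X)"
  by (rule lin_restrict_tot[OF lin_dc])
    (simp add: dc_def subspD(5,8)[OF subsp_tot] del_tot delbar_tot)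

text \<open>
  On an element of bidegree \<open>(p, q)\<close> the three parts of \<open>d (d x) = 0\<close> have bidegrees \<open>(p + 2, q)\<close>,
  \<open>(p + 1, q + 1)\<close> and \<open>(p, q + 2)\<close>, so each of them vanishes.
\<close>
lemma bicomplex_relations_piece:
  assumes x: "x \<in> piece X p q"
  shows "del X (del X x) = \<zero>\<^bsub>A\<^esub>" "delbar X (delbar X x) = \<zero>\<^bsub>A\<^esub>"
    "del X (delbar X x) \<oplus>\<^bsub>A\<^esub> delbar X (del X x) = \<zero>\<^bsub>A\<^esub>"
proof -
  let ?y = "\<lambda>i::nat. if i = 0 then del X (del X x) else
    if i = 1 then del X (delbar X x) \<oplus>\<^bsub>A\<^esub> delbar X (del X x) else delbar X (delbar X x)"
  let ?\<beta> = "\<lambda>i::nat. (p + (2 - int i), q + int i)"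
  have xA: "x \<in> carrier A" using x by (rule piece_carrier)
  have "finsum A ?y {0, 1, 2} = dtot X (dtot X x)"
    using xA by (simp add: A.finsum_insert linA dtot_def A.a_ac)
  then have sum: "finsum A ?y {0, 1, 2} = \<zero>\<^bsub>A\<^esub>" using dtot_dtot[OF xA] by simp
  have "del X (del X x) \<in> piece X (p + 2) q" "delbar X (delbar X x) \<in> piece X p (q + 2)"
    "del X (delbar X x) \<in> piece X (p + 1) (q + 1)" "delbar X (del X x) \<in> piece X (p + 1) (q + 1)"
    using del_piece[OF del_piece[OF x]] delbar_piece[OF delbar_piece[OF x]]
      del_piece[OF delbar_piece[OF x]] delbar_piece[OF del_piece[OF x]] by (simp_all add: add.assoc)
  then have "?y i \<in> piece X (fst (?\<beta> i)) (snd (?\<beta> i))" if "i \<in> {0, 1, 2}" for i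
    using that subspD(4)[OF subspace_piece] by auto
  from components_zero[OF _ _ this sum] have "?y i = \<zero>\<^bsub>A\<^esub>" if "i \<in> {0, 1, 2}" for i
    using that by (auto simp: inj_on_def)
  from this[of 0] this[of 1] this[of 2] show "del X (del X x) = \<zero>\<^bsub>A\<^esub>" "delbar X (delbar X x) = \<zero>\<^bsub>A\<^esub>"
    "del X (delbar X x) \<oplus>\<^bsub>A\<^esub> delbar X (del X x) = \<zero>\<^bsub>A\<^esub>" by simp_all
qed

lemma bicomplex_relations:
  assumes x: "x \<in> carrier (tot X k)"
  shows "del X (del X x) = \<zero>\<^bsub>A\<^esub>" "delbar X (delbar X x) = \<zero>\<^bsub>A\<^esub>"
    "del X (delbar X x) = \<ominus>\<^bsub>A\<^esub> delbar X (del X x)"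
proof -
  show "del X (del X x) = \<zero>\<^bsub>A\<^esub>"
    using x by (induction rule: tot_induct) (auto simp: bicomplex_relations_piece linA)
  show "delbar X (delbar X x) = \<zero>\<^bsub>A\<^esub>"
    using x by (induction rule: tot_induct) (auto simp: bicomplex_relations_piece linA)
  show "del X (delbar X x) = \<ominus>\<^bsub>A\<^esub> delbar X (del X x)"
    using x
  proof (induction rule: tot_induct)
    case (piece p y)
    then show ?case
      using bicomplex_relations_piece(3)[OF piece] piece_carrier[OF piece]
      by (intro A.minus_equality[symmetric]) (auto simp: linA)
  qed (auto simp: linA A.minus_add)
qed

lemma dc_dc: "x \<in> carrier (tot X k) \<Longrightarrow> dc X (dc X x) = \<zero>\<^bsub>A\<^esub>"
  using bicomplex_relations[of x k] tot_carrier[of x k]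
  by (simp add: dc_def a_minus_def linA smultA A.l_neg A.r_neg minus_zeroA linD(7)[OF lin_smult[OF vs]])

section \<open>The differential maps the kernel of the twisted differential into its image\<close>

lemma finsum_shift:
  assumes "finite S" "finite T" "(\<lambda>p. p + 1) ` S \<subseteq> T" "\<And>p. g p \<in> carrier A" "\<And>p. p \<notin> S \<Longrightarrow> g p = \<zero>\<^bsub>A\<^esub>"
  shows "finsum A (\<lambda>p. g (p - 1)) T = finsum A g (S :: int set)"
proof -
  have "p - 1 \<notin> S" if "p \<in> T - (\<lambda>p. p + 1) ` S" for p
    using that by (metis DiffD2 diff_add_cancel imageI)
  then have "finsum A (\<lambda>p. g (p - 1)) T = finsum A (\<lambda>p. g (p - 1)) ((\<lambda>p. p + 1) ` S)"
    using assms by (intro A.add.finprod_mono_neutral_cong_right) auto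
  also have "\<dots> = finsum A (\<lambda>p. g (p + 1 - 1)) S"
    using assms(4) by (intro A.finsum_reindex) (auto simp: inj_on_def)
  finally show ?thesis by simp
qed

text \<open>
  Write \<open>x\<close> as the sum of components \<open>c p\<close> of bidegree \<open>(p, k - p)\<close>. Comparing the components of
  bidegree \<open>(p, k + 1 - p)\<close> in \<open>d\<^sup>c x = 0\<close> gives the recurrence \<open>delbar (c p) = del (c (p - 1))\<close>. For
  \<open>y = \<Sum> w p c p\<close> the recurrence turns \<open>delbar y - del y\<close> into \<open>\<Sum> (w (p + 1) - w p) del (c p)\<close>.
  With \<open>w p = - 2 i p\<close> all these weights equal \<open>- 2 i\<close>, and multiplying by \<open>i\<close> gives
  \<open>d\<^sup>c y = 2 del x = d x\<close>.
\<close>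
lemma dtot_in_image_dc:
  assumes x: "x \<in> carrier (tot X k)" and dcx: "dc X x = \<zero>\<^bsub>A\<^esub>"
  shows "dtot X x \<in> dc X ` carrier (tot X k)"
proof -
  have xA: "x \<in> carrier A" by (rule tot_carrier[OF x])
  have "(- \<i>) \<odot>\<^bsub>A\<^esub> dc X x = delbar X x \<ominus>\<^bsub>A\<^esub> del X x"
    using xA unfolding dc_def by (subst smultA(4)[symmetric]) (auto simp: linA smultA)
  then have "delbar X x \<ominus>\<^bsub>A\<^esub> del X x = \<zero>\<^bsub>A\<^esub>"
    using dcx by (simp add: smultA(7))
  then have eq: "delbar X x = del X x"
    using xA by (simp add: linA)
  obtain c S where S: "finite S" and c: "\<And>p. c p \<in> piece X p (k - p)"
    and c0: "\<And>p. p \<notin> S \<Longrightarrow> c p = \<zero>\<^bsub>A\<^esub>" and xc: "x = finsum A c S"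
    using x by (auto simp: carrier_tot_iff)
  have cA [simp]: "c p \<in> carrier A" for p using c piece_carrier by blast
  note [simp] = linA(1,2,9,10) smultA(1,7)
  \<comment> \<open>\<open>T\<close> contains every \<open>p\<close> for which \<open>c p\<close> or \<open>c (p - 1)\<close> may be nonzero\<close>
  define T where "T = S \<union> (\<lambda>p. p + 1) ` S"
  have T: "finite T" "S \<subseteq> T" "(\<lambda>p. p + 1) ` S \<subseteq> T" using S by (auto simp: T_def)
  have delx: "del X x = finsum A (\<lambda>p. del X (c p)) S"
    unfolding xc using S by (intro lin_finsum linear_del) auto
  have extend: "finsum A g S = finsum A g T" if "\<And>p. g p \<in> carrier A" "\<And>p. p \<notin> S \<Longrightarrow> g p = \<zero>\<^bsub>A\<^esub>" for g
    using T that by (intro A.add.finprod_mono_neutral_cong_left) auto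
  have delbarx: "delbar X x = finsum A (\<lambda>p. delbar X (c p)) T"
    unfolding xc using S c0 by (subst lin_finsum[OF linear_delbar]) (auto intro!: extend)
  have e_sum: "finsum A (\<lambda>p. delbar X (c p) \<ominus>\<^bsub>A\<^esub> del X (c (p - 1))) T = \<zero>\<^bsub>A\<^esub>"
  proof -
    have "finsum A (\<lambda>p. del X (c (p - 1))) T = del X x"
      unfolding delx using S T c0 by (intro finsum_shift) auto
    moreover have "finsum A (\<lambda>p. \<ominus>\<^bsub>A\<^esub> del X (c (p - 1))) T = \<ominus>\<^bsub>A\<^esub> finsum A (\<lambda>p. del X (c (p - 1))) T"
      using T lin_finsum[OF lin_smult[OF vs, of "- 1"], of T "\<lambda>p. del X (c (p - 1))"]
      by (simp add: smultA(8) A.finsum_closed)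
    ultimately show ?thesis
      using delbarx eq xA T by (simp add: a_minus_def A.finsum_addf A.r_neg)
  qed
  have e_piece: "delbar X (c p) \<ominus>\<^bsub>A\<^esub> del X (c (p - 1)) \<in> piece X p (k + 1 - p)" for p
    using delbar_piece[OF c[of p]] del_piece[OF c[of "p - 1"]] subspD(8)[OF subspace_piece, of _ p "k + 1 - p"]
    by (simp add: algebra_simps)
  have "delbar X (c p) \<ominus>\<^bsub>A\<^esub> del X (c (p - 1)) = \<zero>\<^bsub>A\<^esub>" if "p \<in> T" for p
    by (rule components_zero[where \<beta> = "\<lambda>p. (p, k + 1 - p)", OF T(1) _ _ e_sum that])
      (simp_all add: inj_on_def e_piece)
  then have rec: "delbar X (c p) = del X (c (p - 1))" if "p \<in> T" for p
    using that by simp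
  define w :: "int \<Rightarrow> complex" where "w p = - 2 * \<i> * of_int p" for p
  define y where "y = finsum A (\<lambda>p. w p \<odot>\<^bsub>A\<^esub> c p) S"
  have y: "y \<in> carrier (tot X k)"
    using S c unfolding y_def by (intro finsum_tot subspD(5)[OF subspace_piece])
  have dely: "del X y = finsum A (\<lambda>p. w p \<odot>\<^bsub>A\<^esub> del X (c p)) S"
    unfolding y_def using S by (subst lin_finsum[OF linear_del]) (auto simp: linA)
  have "delbar X y = finsum A (\<lambda>p. w p \<odot>\<^bsub>A\<^esub> delbar X (c p)) T"
    unfolding y_def using S c0 by (subst lin_finsum[OF linear_delbar]) (auto simp: linA intro!: extend)
  also have "\<dots> = finsum A (\<lambda>p. w (p - 1 + 1) \<odot>\<^bsub>A\<^esub> del X (c (p - 1))) T"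
    using rec by (intro A.finsum_cong') auto
  also have "\<dots> = finsum A (\<lambda>p. w (p + 1) \<odot>\<^bsub>A\<^esub> del X (c p)) S"
    using S T c0 by (intro finsum_shift[where g = "\<lambda>p. w (p + 1) \<odot>\<^bsub>A\<^esub> del X (c p)"]) auto
  also have "\<dots> = finsum A (\<lambda>p. (- 2 * \<i>) \<odot>\<^bsub>A\<^esub> del X (c p) \<oplus>\<^bsub>A\<^esub> w p \<odot>\<^bsub>A\<^esub> del X (c p)) S"
    by (intro A.finsum_cong') (auto simp: w_def algebra_simps simp flip: smultA(2))
  also have "\<dots> = (- 2 * \<i>) \<odot>\<^bsub>A\<^esub> del X x \<oplus>\<^bsub>A\<^esub> del X y"
    unfolding dely delx using S lin_finsum[OF lin_smult[OF vs, of "- 2 * \<i>"], of S "\<lambda>p. del X (c p)"]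
    by (simp add: A.finsum_addf)
  finally have "delbar X y \<ominus>\<^bsub>A\<^esub> del X y = (- 2 * \<i>) \<odot>\<^bsub>A\<^esub> del X x"
    using xA tot_carrier[OF y] by (simp add: a_minus_def A.a_assoc A.r_neg)
  then have "dc X y = (\<i> * (- 2 * \<i>)) \<odot>\<^bsub>A\<^esub> del X x"
    using xA smultA(4)[of "del X x" \<i> "- 2 * \<i>"] by (simp add: dc_def)
  also have "\<i> * (- 2 * \<i>) = 1 + 1" by (simp add: complex_eq_iff)
  also have "(1 + 1) \<odot>\<^bsub>A\<^esub> del X x = dtot X x"
    using xA eq smultA(2)[of "del X x" 1 1] by (simp add: smultA(5) dtot_def)
  finally show ?thesis using y by (metis imageI)
qed

end

section \<open>A direct summand with zero differential\<close>

text \<open>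
  The snake lemma yields the cohomology of a direct sum of complexes in the middle, whereas the
  direct sum of the cohomologies is wanted. The maps need to match only on carriers, because their
  values elsewhere depend on how they are encoded.
\<close>
lemma long_exact_sequence_transport:
  assumes les: "long_exact_sequence P Q R u v \<delta>"
    and lin: "\<And>k. lin (Q k) (Q' k) (\<phi> k)"
    and bij: "\<And>k. bij_betw (\<phi> k) (carrier (Q k)) (carrier (Q' k))"
    and u': "\<And>k x. x \<in> carrier (P k) \<Longrightarrow> u' k x = \<phi> k (u k x)"
    and v': "\<And>k y. y \<in> carrier (Q k) \<Longrightarrow> v' k (\<phi> k y) = v k y"
  shows "long_exact_sequence P Q' R u' v' \<delta>"
proof -
  have lu: "lin (P k) (Q k) (u k)" and lv: "lin (Q k) (R k) (v k)" and ld: "lin (R k) (P (k + 1)) (\<delta> k)"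
    and eu: "u k ` carrier (P k) = a_kernel (Q k) (R k) (v k)"
    and ev: "v k ` carrier (Q k) = a_kernel (R k) (P (k + 1)) (\<delta> k)"
    and ed: "\<delta> k ` carrier (R k) = a_kernel (P (k + 1)) (Q (k + 1)) (u (k + 1))" for k
    using les unfolding long_exact_sequence_def exact_at_def by blast+
  have Q': "carrier (Q' k) = \<phi> k ` carrier (Q k)" for k
    using bij by (simp add: bij_betw_def)
  have \<phi>0: "\<phi> k y = \<zero>\<^bsub>Q' k\<^esub> \<longleftrightarrow> y = \<zero>\<^bsub>Q k\<^esub>" if "y \<in> carrier (Q k)" for k y
  proof -
    interpret abelian_group "Q k" by (rule vspace_abelian_group[OF linD(1)[OF lin]])
    show ?thesis
      using inj_onD[OF bij_betw_imp_inj_on[OF bij[of k]], of y "\<zero>\<^bsub>Q k\<^esub>"] that linD(6)[OF lin[of k]] by auto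
  qed
  have lu': "lin (P k) (Q' k) (u' k)" for k
    by (rule lin_cong[OF lin_comp[OF lu lin] u'])
  have lv': "lin (Q' k) (R k) (v' k)" for k
  proof (rule linI[OF linD(2)[OF lin] linD(2)[OF lv]])
    interpret abelian_group "Q k" by (rule vspace_abelian_group[OF linD(1)[OF lin]])
    fix z assume "z \<in> carrier (Q' k)"
    then obtain y where y: "y \<in> carrier (Q k)" "z = \<phi> k y" by (auto simp: Q')
    show "v' k z \<in> carrier (R k)" using y v'[OF y(1)] linD(3)[OF lv y(1)] by simp
    show "v' k (c \<odot>\<^bsub>Q' k\<^esub> z) = c \<odot>\<^bsub>R k\<^esub> v' k z" for c
      using y v'[OF y(1)] v'[of "c \<odot>\<^bsub>Q k\<^esub> y" k] linD(5)[OF lin y(1)] linD(5)[OF lv y(1)]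
      by (simp add: vspace_smult(1)[OF linD(1)[OF lin]])
    fix z' assume "z' \<in> carrier (Q' k)"
    then obtain y' where y': "y' \<in> carrier (Q k)" "z' = \<phi> k y'" by (auto simp: Q')
    show "v' k (z \<oplus>\<^bsub>Q' k\<^esub> z') = v' k z \<oplus>\<^bsub>R k\<^esub> v' k z'"
      using y y' v'[OF y(1)] v'[OF y'(1)] v'[of "y \<oplus>\<^bsub>Q k\<^esub> y'" k] linD(4)[OF lin y(1) y'(1)]
        linD(4)[OF lv y(1) y'(1)] by simp
  qed
  have eu': "u' k ` carrier (P k) = a_kernel (Q' k) (R k) (v' k)" for k
  proof -
    have "u' k ` carrier (P k) = \<phi> k ` (u k ` carrier (P k))"
      using u' by (auto simp: image_image)
    also have "\<dots> = a_kernel (Q' k) (R k) (v' k)"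
      unfolding eu using v' by (auto simp: a_kernel_iff Q')
    finally show ?thesis .
  qed
  have ev': "v' k ` carrier (Q' k) = a_kernel (R k) (P (k + 1)) (\<delta> k)" for k
    unfolding ev[symmetric] Q' image_image by (rule image_cong[OF refl v'])
  have ed': "\<delta> k ` carrier (R k) = a_kernel (P (k + 1)) (Q' (k + 1)) (u' (k + 1))" for k
    unfolding ed using u' \<phi>0[OF linD(3)[OF lu]] by (auto simp: a_kernel_iff linD(6)[OF lin])
  show ?thesis
    unfolding long_exact_sequence_def exact_at_def by (intro allI conjI lu' lv' ld eu' ev' ed')
qed

lemma direct_sum_complex_simps [simp]:
  "obj (direct_sum_complex D H) k = direct_sum (obj D k) (obj H k)"
  "diff (direct_sum_complex D H) k (x, y) = (diff D k x, diff H k y)"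
  by (simp_all add: direct_sum_complex_def)

lemma direct_sum_complex_complex:
  assumes "cochain_complex D" "cochain_complex H"
  shows "cochain_complex (direct_sum_complex D H)"
proof -
  interpret D: complexes D by unfold_locales fact
  interpret H: complexes H by unfold_locales fact
  show ?thesis unfolding cochain_complex_def
  proof (intro allI conjI ballI)
    fix k
    show "lin (obj (direct_sum_complex D H) k) (obj (direct_sum_complex D H) (k + 1)) (diff (direct_sum_complex D H) k)"
      using lin_prod[OF D.lin_diff H.lin_diff] by (simp add: direct_sum_complex_def)
    fix z assume "z \<in> carrier (obj (direct_sum_complex D H) k)"
    then show "diff (direct_sum_complex D H) (k + 1) (diff (direct_sum_complex D H) k z) =
        \<zero>\<^bsub>obj (direct_sum_complex D H) (k + 2)\<^esub>"
      using D.diff_diff H.diff_diff by (auto simp: add.assoc)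
  qed
qed

text \<open>
  If the differential of \<open>H\<close> vanishes, the only coboundary of \<open>H\<close> is zero, so the class of \<open>(a, h)\<close> in
  the direct sum is the product of the class of \<open>a\<close> with the singleton \<open>{h}\<close>. Its two projections
  recover the class of \<open>a\<close> and \<open>h\<close>.
\<close>
definition split_class :: "('a \<times> 'b) set \<Rightarrow> 'a set \<times> 'b" where
  "split_class Z = (fst ` Z, the_elem (snd ` Z))"

locale zero_differential_summand = D: complexes D + H: complexes H for D :: "'a cochain" and H :: "'b cochain" +
  assumes zero_diff: "diff H k h = \<zero>\<^bsub>obj H (k + 1)\<^esub>"
begin

abbreviation S where "S \<equiv> direct_sum_complex D H"

sublocale S: complexes S
  by unfold_locales (rule direct_sum_complex_complex[OF D.complex H.complex])

lemma cocycles_S: "cocycles S k = cocycles D k \<times> carrier (obj H k)"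
  by (auto simp: S.cocycles_iff D.cocycles_iff zero_diff)

lemma split_class_hclass:
  assumes "h \<in> carrier (obj H k)"
  shows "split_class (cohomology_class S k (a, h)) = (cohomology_class D k a, h)"
proof -
  have zero: "diff H (k - 1) h' = \<zero>\<^bsub>obj H k\<^esub>" for h' using zero_diff[of "k - 1"] by simp
  have "(x, y) \<in> cohomology_class S k (a, h) \<longleftrightarrow> x \<in> cohomology_class D k a \<and> y = h" for x y
    unfolding S.mem_hclass D.mem_hclass using assms H.O.zero_closed[of "k - 1"] by (auto simp: zero)
  then have "cohomology_class S k (a, h) = cohomology_class D k a \<times> {h}" by auto
  moreover have "cohomology_class D k a \<noteq> {}"
    using D.O.zero_closed[of "k - 1"] by (auto simp: D.mem_hclass ex_in_conv[symmetric])
  ultimately show ?thesis by (simp add: split_class_def)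
qed

lemma bij_split_class:
  "bij_betw split_class (carrier (cohomology S k)) (carrier (direct_sum (cohomology D k) (obj H k)))"
proof -
  have "carrier (direct_sum (cohomology D k) (obj H k)) = split_class ` carrier (cohomology S k)"
    unfolding S.carrier_cohomology cocycles_S image_image direct_sum_simps D.carrier_cohomology
    by (force simp: split_class_hclass image_iff)
  moreover have "inj_on split_class (carrier (cohomology S k))"
  proof (rule inj_onI)
    fix Z Z' assume "Z \<in> carrier (cohomology S k)" "Z' \<in> carrier (cohomology S k)"
    then obtain a h a' h' where z: "a \<in> cocycles D k" "h \<in> carrier (obj H k)" "Z = cohomology_class S k (a, h)"
      "a' \<in> cocycles D k" "h' \<in> carrier (obj H k)" "Z' = cohomology_class S k (a', h')"
      by (auto simp: S.carrier_cohomology cocycles_S)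
    assume "split_class Z = split_class Z'"
    then have "cohomology_class D k a = cohomology_class D k a'" "h = h'"
      using z by (auto simp: split_class_hclass)
    then have "(a, h) \<in> cohomology_class S k (a', h')"
      using D.hclass_self[OF z(1)] z H.O.zero_closed[of "k - 1"] zero_diff[of "k - 1"]
      by (auto simp: S.mem_hclass D.mem_hclass)
    then show "Z = Z'"
      using z by (auto intro!: S.hclass_eqI simp: cocycles_S)
  qed
  ultimately show ?thesis by (simp add: bij_betw_def)
qed

lemma lin_split_class: "lin (cohomology S k) (direct_sum (cohomology D k) (obj H k)) split_class"
proof (rule linI[OF S.vspace_cohomology direct_sum_is_vs[OF D.vspace_cohomology H.vs]])
  fix Z assume "Z \<in> carrier (cohomology S k)"
  then obtain a h where z: "a \<in> cocycles D k" "h \<in> carrier (obj H k)" "Z = cohomology_class S k (a, h)"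
    by (auto simp: S.carrier_cohomology cocycles_S)
  then show "split_class Z \<in> carrier (direct_sum (cohomology D k) (obj H k))"
    by (auto simp: split_class_hclass D.carrier_cohomology)
  show "split_class (c \<odot>\<^bsub>cohomology S k\<^esub> Z) = c \<odot>\<^bsub>direct_sum (cohomology D k) (obj H k)\<^esub> split_class Z" for c
    using z by (simp add: S.smult_cohomology D.smult_cohomology cocycles_S split_class_hclass vspace_smult(1)[OF H.vs])
  fix Z' assume "Z' \<in> carrier (cohomology S k)"
  then obtain a' h' where z': "a' \<in> cocycles D k" "h' \<in> carrier (obj H k)" "Z' = cohomology_class S k (a', h')"
    by (auto simp: S.carrier_cohomology cocycles_S)
  show "split_class (Z \<oplus>\<^bsub>cohomology S k\<^esub> Z') =
      split_class Z \<oplus>\<^bsub>direct_sum (cohomology D k) (obj H k)\<^esub> split_class Z'"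
    using z z' by (simp add: S.add_cohomology D.add_cohomology cocycles_S split_class_hclass)
qed

end

section \<open>The short exact sequence of a bicomplex\<close>

context bicomplex
begin

lemma complex_simps [simp]:
  "obj (d_complex X) k = tot X k" "diff (d_complex X) k = dtot X"
  "obj (dc_complex X) k = tot X k" "diff (dc_complex X) k = dc X"
  "obj (ker_dc X) k = (tot X k)\<lparr>carrier := cocycles (dc_complex X) k\<rparr>" "diff (ker_dc X) k = dtot X"
  "obj (H_dc X) k = cohomology (dc_complex X) k"
  "diff (H_dc X) k h = \<zero>\<^bsub>cohomology (dc_complex X) (k + 1)\<^esub>"
  "obj (coker_dc X) k = quotient_space (tot X k) (coboundaries (dc_complex X) k)"
  "diff (coker_dc X) k =
    induced_map (tot X (k + 1)) (coboundaries (dc_complex X) (k + 1)) (dtot X)"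
  by (simp_all add: d_complex_def dc_complex_def ker_dc_def H_dc_def coker_dc_def)

sublocale d: complexes "d_complex X"
  by unfold_locales
    (auto simp: cochain_complex_def lin_tot_dtot dtot_dtot tot_carrier)

sublocale dc: complexes "dc_complex X"
  by unfold_locales
    (auto simp: cochain_complex_def lin_tot_dc intro: dc_dc)

abbreviation B where "B \<equiv> coboundaries (dc_complex X)"
abbreviation Z where "Z \<equiv> cocycles (dc_complex X)"

lemma Z_iff: "x \<in> Z k \<longleftrightarrow> x \<in> carrier (tot X k) \<and> dc X x = \<zero>\<^bsub>A\<^esub>"
  by (simp add: dc.cocycles_iff)

lemma B_eq: "B k = dc X ` carrier (tot X (k - 1))"
  by (simp add: coboundaries_def)

text \<open>
  Since \<open>B k \<subseteq> Z k\<close>, this one inclusion makes \<open>d\<close> act on \<open>Z\<close> and on the quotient by \<open>B\<close>, and makes \<open>\<pi>\<close>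
  and \<open>j\<close> compatible with the zero differential on \<open>H\<^sub>d\<^sub>c\<close>.
\<close>
lemma dtot_Z: "x \<in> Z k \<Longrightarrow> dtot X x \<in> B (k + 1)"
  using dtot_in_image_dc[of x k] by (auto simp: Z_iff B_eq)

lemma dtot_Z_Z: "x \<in> Z k \<Longrightarrow> dtot X x \<in> Z (k + 1)"
  using dtot_Z dc.coboundaries_cocycles by blast

lemma dtot_B: "x \<in> B k \<Longrightarrow> dtot X x \<in> B (k + 1)"
  using dc.coboundaries_cocycles dtot_Z by blast

sublocale T: quotient "tot X k" "B k" for k
  by (rule quotient.intro) (use dc.subsp_coboundaries[of k] in simp)

lemma lin_dtot_coker:
  "lin (quotient_space (tot X k) (B k)) (quotient_space (tot X (k + 1)) (B (k + 1)))
    (induced_map (tot X (k + 1)) (B (k + 1)) (dtot X))"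
  by (rule lin_induced_map[OF T.sub T.sub lin_tot_dtot]) (auto intro: dtot_B)

lemma dtot_coker:
  "x \<in> carrier (tot X k) \<Longrightarrow>
    induced_map (tot X (k + 1)) (B (k + 1)) (dtot X) (T.cls k x) = T.cls (k + 1) (dtot X x)"
  by (rule induced_map_lin[OF T.sub T.sub lin_tot_dtot]) (auto intro: dtot_B)

sublocale ker: complexes "ker_dc X"
proof (unfold_locales, unfold cochain_complex_def, intro allI conjI ballI)
  fix k
  have vs: "vspace ((tot X k)\<lparr>carrier := Z k\<rparr>)" for k
    using subspD(9)[OF dc.subsp_cocycles[of k]] by simp
  show "lin (obj (ker_dc X) k) (obj (ker_dc X) (k + 1)) (diff (ker_dc X) k)"
    using linD(4,5)[OF lin_tot_dtot[of k]] dtot_Z_Z vs by (intro linI) (auto simp: Z_iff)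
  show "diff (ker_dc X) (k + 1) (diff (ker_dc X) k x) = \<zero>\<^bsub>obj (ker_dc X) (k + 2)\<^esub>"
    if "x \<in> carrier (obj (ker_dc X) k)" for x
    using that dtot_dtot[OF tot_carrier[of x k]] by (simp add: Z_iff)
qed

sublocale H: complexes "H_dc X"
  by unfold_locales
    (auto simp: cochain_complex_def add.assoc
      intro!: lin_cong[OF lin_zero[OF dc.vspace_cohomology dc.vspace_cohomology]])

sublocale coker: complexes "coker_dc X"
proof (unfold_locales, unfold cochain_complex_def, intro allI conjI ballI)
  fix k
  show "lin (obj (coker_dc X) k) (obj (coker_dc X) (k + 1)) (diff (coker_dc X) k)"
    using lin_dtot_coker by simp
  fix x assume "x \<in> carrier (obj (coker_dc X) k)"
  then obtain a where a: "a \<in> carrier (tot X k)" "x = T.cls k a" by (auto simp: T.carrier_Q)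
  have "dtot X a \<in> carrier (tot X (k + 1))" using linD(3)[OF lin_tot_dtot a(1)] .
  then have "diff (coker_dc X) (k + 1) (diff (coker_dc X) k x) = T.cls (k + 1 + 1) (dtot X (dtot X a))"
    by (simp only: a complex_simps dtot_coker)
  then show "diff (coker_dc X) (k + 1) (diff (coker_dc X) k x) = \<zero>\<^bsub>obj (coker_dc X) (k + 2)\<^esub>"
    using dtot_dtot[OF tot_carrier[OF a(1)]] T.cls_zero[of "k + 2"] by (simp add: T.zero_Q add.assoc)
qed

abbreviation S where "S \<equiv> direct_sum_complex (d_complex X) (H_dc X)"

sublocale dH: zero_differential_summand "d_complex X" "H_dc X"
  by unfold_locales simp

lemma lin_proj_H: "lin (obj (ker_dc X) k) (cohomology (dc_complex X) k) (proj_H X k)"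
  using dc.H.lin_cls[of k] by (simp add: proj_H_def[abs_def] cohomology_class_def cohomology_def)

lemma proj_H_B: "x \<in> B k \<Longrightarrow> proj_H X k x = \<zero>\<^bsub>cohomology (dc_complex X) k\<^esub>"
  using dc.coboundaries_cocycles dc.hclass_eq_zero_iff[of x k]
  by (auto simp: proj_H_def B_eq)

lemma proj_H_cls: "proj_H X k x = T.cls k x"
  by (simp add: proj_H_def cohomology_class_def)

lemma carrier_H: "carrier (cohomology (dc_complex X) k) = T.cls k ` Z k"
  by (simp add: dc.carrier_cohomology cohomology_class_def)

lemma zero_H: "\<zero>\<^bsub>cohomology (dc_complex X) k\<^esub> = B k"
  using T.cls_zero[of k] by (simp add: dc.zero_cohomology cohomology_class_def)

lemma lin_incl_H: "lin (cohomology (dc_complex X) k) (obj (coker_dc X) k) (incl_H X k)"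
proof -
  have "T.cls k x \<oplus>\<^bsub>cohomology (dc_complex X) k\<^esub> T.cls k y = T.cls k (x \<oplus>\<^bsub>A\<^esub> y)"
    "c \<odot>\<^bsub>cohomology (dc_complex X) k\<^esub> T.cls k x = T.cls k (c \<odot>\<^bsub>A\<^esub> x)"
    if "x \<in> Z k" "y \<in> Z k" for x y c
    using dc.add_cohomology[OF that] dc.smult_cohomology[OF that(1)] by (simp_all add: cohomology_class_def)
  then show ?thesis
    by (intro linI[OF dc.vspace_cohomology coker.vs])
      (auto simp: carrier_H incl_H_def T.carrier_Q T.add_Q T.smult_Q Z_iff)
qed

lemma lin_proj_coker: "lin (tot X k) (obj (coker_dc X) k) (proj_coker X k)"
  using T.lin_cls[of k] by (simp add: proj_coker_def[abs_def])

lemma i_plus_pi_eq: "i_plus_pi X k x = (x, T.cls k x)"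
  by (simp add: i_plus_pi_def incl_def proj_H_cls)

text \<open>
  A class in \<open>H\<^sub>d\<^sub>c\<close> and its image under \<open>j\<close> are the same coset of \<open>B k\<close>, so \<open>p - j\<close> can be computed on
  representatives.
\<close>
lemma p_minus_j_eq:
  "a \<in> carrier (tot X k) \<Longrightarrow> x \<in> Z k \<Longrightarrow> p_minus_j X k (a, T.cls k x) = T.cls k (a \<ominus>\<^bsub>tot X k\<^esub> x)"
  by (simp add: p_minus_j_def incl_H_def proj_coker_def T.minus_Q Z_iff)

lemma chain_map_i_plus_pi: "chain_map (ker_dc X) S (i_plus_pi X)"
  unfolding chain_map_def
proof (intro allI conjI ballI)
  fix k
  have "lin (obj (ker_dc X) k) (tot X k) (incl X k)"
    using ker.vs[of k] vspace_tot by (intro linI) (auto simp: incl_def Z_iff)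
  from lin_pair[OF this lin_proj_H[of k]]
  show "lin (obj (ker_dc X) k) (obj S k) (i_plus_pi X k)"
    by (simp add: i_plus_pi_def[abs_def])
  fix x assume "x \<in> carrier (obj (ker_dc X) k)"
  then show "i_plus_pi X (k + 1) (diff (ker_dc X) k x) = diff S k (i_plus_pi X k x)"
    using proj_H_B[OF dtot_Z[of x k]] by (simp add: i_plus_pi_def incl_def)
qed

text \<open>
  On \<open>(a, [x])\<close> the map \<open>p - j\<close> followed by \<open>d\<close> gives \<open>[d a - d x]\<close>, and in the other order it gives
  \<open>[d a]\<close>; they agree because \<open>d x\<close> lies in the image of \<open>d\<^sup>c\<close>.
\<close>
lemma chain_map_p_minus_j: "chain_map S (coker_dc X) (p_minus_j X)"
  unfolding chain_map_def
proof (intro allI conjI ballI)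
  fix k
  show "lin (obj S k) (obj (coker_dc X) k) (p_minus_j X k)"
    using lin_difference[OF lin_proj_coker lin_incl_H] by (simp add: p_minus_j_def)
  fix z assume "z \<in> carrier (obj S k)"
  then obtain a x where z: "a \<in> carrier (tot X k)" "x \<in> Z k" "z = (a, T.cls k x)"
    by (auto simp: carrier_H)
  have x: "x \<in> carrier (tot X k)" using z by (simp add: Z_iff)
  note d = linD(3)[OF lin_tot_dtot z(1)] linD(3)[OF lin_tot_dtot x]
  have B0: "T.cls (k + 1) (dtot X x) = B (k + 1)"
    using T.cls_eq_zero_iff[OF d(2)] dtot_Z[OF z(2)] by simp
  have "p_minus_j X (k + 1) (diff S k z) = p_minus_j X (k + 1) (dtot X a, T.cls (k + 1) (dtot X x))"
    using z by (simp add: zero_H B0)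
  also have "\<dots> = T.cls (k + 1) (dtot X a \<ominus>\<^bsub>tot X (k + 1)\<^esub> dtot X x)"
    using d dtot_Z_Z[OF z(2)] by (simp add: p_minus_j_eq)
  also have "\<dots> = T.cls (k + 1) (dtot X (a \<ominus>\<^bsub>tot X k\<^esub> x))"
    using linD(8)[OF lin_tot_dtot z(1) x] by simp
  also have "\<dots> = diff (coker_dc X) k (p_minus_j X k z)"
    using z x by (simp add: p_minus_j_eq dtot_coker T.M.minus_closed)
  finally show "p_minus_j X (k + 1) (diff S k z) = diff (coker_dc X) k (p_minus_j X k z)" .
qed

lemma short_exact: "short_exact_complexes (ker_dc X) S (coker_dc X) (i_plus_pi X) (p_minus_j X)"
  unfolding short_exact_complexes_def
proof (intro conjI allI ker.complex dH.S.complex coker.complex chain_map_i_plus_pi chain_map_p_minus_j)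
  fix k
  show "inj_on (i_plus_pi X k) (carrier (obj (ker_dc X) k))"
    by (auto simp: inj_on_def i_plus_pi_eq)
  show "exact_at (obj (ker_dc X) k) (obj S k) (obj (coker_dc X) k) (i_plus_pi X k) (p_minus_j X k)"
    unfolding exact_at_def
  proof (intro equalityI subsetI)
    fix z assume "z \<in> i_plus_pi X k ` carrier (obj (ker_dc X) k)"
    then obtain x where x: "x \<in> Z k" "z = (x, T.cls k x)" by (auto simp: i_plus_pi_eq)
    then have "p_minus_j X k z = \<zero>\<^bsub>obj (coker_dc X) k\<^esub>"
      using T.cls_zero[of k] T.M.r_neg[of x k] by (simp add: p_minus_j_eq Z_iff T.zero_Q a_minus_def)
    then show "z \<in> a_kernel (obj S k) (obj (coker_dc X) k) (p_minus_j X k)"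
      using x by (auto simp: a_kernel_iff carrier_H Z_iff)
  next
    fix z assume "z \<in> a_kernel (obj S k) (obj (coker_dc X) k) (p_minus_j X k)"
    then obtain a x where z: "a \<in> carrier (tot X k)" "x \<in> Z k" "z = (a, T.cls k x)"
      and "p_minus_j X k z = B k"
      by (auto simp: a_kernel_iff carrier_H T.zero_Q)
    then have "a \<ominus>\<^bsub>tot X k\<^esub> x \<in> B k"
      using T.cls_eq_zero_iff[of "a \<ominus>\<^bsub>tot X k\<^esub> x" k] T.M.minus_closed[of a k x] by (simp add: p_minus_j_eq Z_iff)
    moreover have "a = (a \<ominus>\<^bsub>tot X k\<^esub> x) \<oplus>\<^bsub>tot X k\<^esub> x"
      using z T.M.a_assoc[of a k "\<ominus>\<^bsub>tot X k\<^esub> x" x] T.M.l_neg[of x k] T.M.r_zero[of a k] T.M.a_inv_closed[of x k]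
      by (simp add: a_minus_def Z_iff)
    ultimately have a: "a \<in> T.cls k x" by (auto simp only: coset_mem)
    then have "a \<in> Z k" "T.cls k a = T.cls k x"
      using z(2) dc.hclass_cocycles[of a k x] T.cls_eqI[OF a] by (simp_all add: cohomology_class_def Z_iff)
    then show "z \<in> i_plus_pi X k ` carrier (obj (ker_dc X) k)"
      using z by (auto simp: i_plus_pi_eq)
  qed
  have "T.cls k a \<in> p_minus_j X k ` carrier (obj S k)" if a: "a \<in> carrier (tot X k)" for a
  proof (rule image_eqI)
    have "\<zero>\<^bsub>A\<^esub> \<in> Z k" using subspD(3)[OF dc.subsp_cocycles[of k]] by simp
    then show "(a, T.cls k \<zero>\<^bsub>A\<^esub>) \<in> carrier (obj S k)" "T.cls k a = p_minus_j X k (a, T.cls k \<zero>\<^bsub>A\<^esub>)"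
      using a T.M.minus_equality[of k "\<zero>\<^bsub>A\<^esub>" "\<zero>\<^bsub>A\<^esub>"] T.M.r_zero[of a k] T.M.zero_closed[of k]
      by (simp_all add: carrier_H p_minus_j_eq a_minus_def)
  qed
  moreover have "p_minus_j X k ` carrier (obj S k) \<subseteq> carrier (obj (coker_dc X) k)"
    by (rule image_subsetI) (rule linD(3)[OF chain_map_p_minus_j[unfolded chain_map_def, rule_format, THEN conjunct1]])
  ultimately show "p_minus_j X k ` carrier (obj S k) = carrier (obj (coker_dc X) k)"
    by (auto simp: T.carrier_Q)
qed

sublocale ses: short_exact "ker_dc X" S "coker_dc X" "i_plus_pi X" "p_minus_j X"
  by unfold_locales (rule short_exact)

section \<open>Identifying the maps in cohomology\<close>

text \<open>
  Representatives of a class in \<open>H(Ker d\<^sup>c)\<close> differ by \<open>d b\<close> with \<open>b\<close> in \<open>Ker d\<^sup>c\<close>. Such an element lies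
  in the image of \<open>d\<^sup>c\<close>, so \<open>\<pi>\<close> is constant on the class.
\<close>
lemma i_plus_pi_cohomology_hclass:
  assumes "x \<in> cocycles (ker_dc X) k"
  shows "i_plus_pi_cohomology X k (cohomology_class (ker_dc X) k x) =
    (cohomology_class (d_complex X) k x, T.cls k x)"
proof -
  interpret i: chain_maps "ker_dc X" "d_complex X" "incl X"
  proof (unfold_locales, unfold chain_map_def, intro allI conjI ballI)
    show "lin (obj (ker_dc X) k) (obj (d_complex X) k) (incl X k)" for k
      using ker.vs[of k] vspace_tot by (intro linI) (auto simp: incl_def Z_iff)
  qed (simp add: incl_def)
  have x: "x \<in> Z k" using assms by (simp add: ker.cocycles_iff)
  have "proj_H X k y = T.cls k x" if "y \<in> cohomology_class (ker_dc X) k x" for y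
  proof -
    from that obtain b where b: "b \<in> Z (k - 1)" "y = dtot X b \<oplus>\<^bsub>A\<^esub> x"
      by (auto simp: ker.mem_hclass)
    then show ?thesis
      using dtot_Z[of b "k - 1"] x unfolding proj_H_cls by (intro T.cls_eqI) (auto simp: coset_mem Z_iff)
  qed
  then have "(\<Union>y\<in>cohomology_class (ker_dc X) k x. proj_H X k y) = T.cls k x"
    using ker.hclass_self[OF assms] by blast
  then show ?thesis
    using i.cohomology_map_hclass[OF assms] by (simp add: i_plus_pi_cohomology_def incl_def)
qed

lemma p_minus_j_cohomology_hclass:
  assumes a: "a \<in> cocycles (d_complex X) k" and x: "x \<in> Z k"
  shows "p_minus_j_cohomology X k (cohomology_class (d_complex X) k a, T.cls k x) =
    cohomology_class (coker_dc X) k (p_minus_j X k (a, T.cls k x))"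
proof -
  interpret p: chain_maps "d_complex X" "coker_dc X" "proj_coker X"
    by unfold_locales (auto simp: chain_map_def lin_proj_coker[simplified] proj_coker_def dtot_coker)
  have xT: "x \<in> carrier (tot X k)" using x by (simp add: Z_iff)
  have "T.cls (k + 1) (dtot X x) = B (k + 1)"
    using T.cls_eq_zero_iff[OF linD(3)[OF lin_tot_dtot xT]] dtot_Z[OF x] by simp
  then have "T.cls k x \<in> cocycles (coker_dc X) k"
    using xT by (simp add: coker.cocycles_iff T.carrier_Q dtot_coker T.zero_Q)
  then show ?thesis
    using p.map_cocycles[OF a]
    by (simp add: p_minus_j_cohomology_def p.cohomology_map_hclass[OF a] incl_H_def coker.minus_cohomology
        p_minus_j_def)
qed

lemma long_exact:
  "long_exact_sequence (cohomology (ker_dc X))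
    (\<lambda>k. direct_sum (cohomology (d_complex X) k) (cohomology (dc_complex X) k))
    (cohomology (coker_dc X)) (i_plus_pi_cohomology X) (p_minus_j_cohomology X)
    (connecting_map (ker_dc X) S (i_plus_pi X) (p_minus_j X))"
proof (rule long_exact_sequence_transport[OF ses.long_exact, where \<phi> = "\<lambda>k. split_class"])
  fix k
  show "lin (cohomology S k) (direct_sum (cohomology (d_complex X) k) (cohomology (dc_complex X) k)) split_class"
    using dH.lin_split_class[of k] by simp
  show "bij_betw split_class (carrier (cohomology S k))
      (carrier (direct_sum (cohomology (d_complex X) k) (cohomology (dc_complex X) k)))"
    using dH.bij_split_class[of k] by simp
next
  fix k Y assume "Y \<in> carrier (cohomology (ker_dc X) k)"
  then obtain x where x: "x \<in> cocycles (ker_dc X) k" "Y = cohomology_class (ker_dc X) k x"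
    by (auto simp: ker.carrier_cohomology)
  then show "i_plus_pi_cohomology X k Y = split_class (cohomology_map S (i_plus_pi X) k Y)"
    by (simp add: i_plus_pi_cohomology_hclass ses.f.cohomology_map_hclass i_plus_pi_eq
        dH.split_class_hclass carrier_H ker.cocycles_iff)
next
  fix k Y assume "Y \<in> carrier (cohomology S k)"
  then obtain a x where "a \<in> cocycles (d_complex X) k" "x \<in> Z k" "Y = cohomology_class S k (a, T.cls k x)"
    by (auto simp: dH.S.carrier_cohomology dH.cocycles_S carrier_H)
  moreover from this have "(a, T.cls k x) \<in> cocycles S k"
    by (simp add: dH.cocycles_S carrier_H)
  ultimately show "p_minus_j_cohomology X k (split_class Y) = cohomology_map (coker_dc X) (p_minus_j X) k Y"
    by (simp add: dH.split_class_hclass carrier_H p_minus_j_cohomology_hclass ses.g.cohomology_map_hclass)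
qed

end

theorem theorem3p6:
  fixes X :: "'a bigraded"
  assumes "bounded_bicomplex X"
  shows "short_exact_complexes
           (ker_dc X) (direct_sum_complex (d_complex X) (H_dc X)) (coker_dc X)
           (i_plus_pi X) (p_minus_j X) \<and>
         long_exact_sequence
           (cohomology (ker_dc X))
           (\<lambda>k. direct_sum (cohomology (d_complex X) k) (cohomology (dc_complex X) k))
           (cohomology (coker_dc X))
           (i_plus_pi_cohomology X)
           (p_minus_j_cohomology X)
           (connecting_map (ker_dc X) (direct_sum_complex (d_complex X) (H_dc X))
             (i_plus_pi X) (p_minus_j X))"
proof -
  interpret bounded_bicomplex X by fact
  show ?thesis using short_exact long_exact by blast
qed

end
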